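(* Let $M\subset\mathbb{R}^2$ be a star-shaped set whose convex hull is a $2$-dimensional convex polytope, let $c$ be a fixed center of $M$, and let $\{M^i\}_{i=0}^m$ be the sectors of $M$ (with respect to $c$). Then, for all $\mathbf{v}\in\mathbb{S}^1$, there is an isomorphism of persistence modules $$\bigoplus_{i=0}^m \widetilde{\mathrm{PH}}_0(M^i,\mathbf{v})\;\cong\;\widetilde{\mathrm{PH}}_0(M,\mathbf{v}).$$
   Context: A set $M\subset\mathbb{R}^d$ is star-shaped if there is a point $c\in M$ (a center) such that for every $x\in M$ the line segment from $c$ to $x$ is contained in $M$. Let $C(M)$ be the convex hull of $M$; here $C(M)$ is a convex polygon with nonempty interior, with vertices $x_0,\dots,x_m$ enumerated cyclically along its boundary. Fix a center $c$. For $0\le i\le m$, let $S_i$ be the convex hull of $\{x_i, x_{(i+1) \bmod (m+1)}, c\}$; the $i$-th sector is $M^i=S_i\cap M$. Fix a field $\mathbb{F}$. For $A\subset\mathbb{R}^d$, $\widetilde{H}_0(A)$ is the $\mathbb{F}$-vector space of formal linear combinations of connected components of $A$ whose coefficients sum to $0$ (so it is $0$ for $A=\emptyset$). For $\mathbf{v}\in\mathbb{S}^{d-1}$ let $h_{\mathbf{v}}(x)=\langle x,\mathbf{v}\rangle$ and $A_{\mathbf{v},t}=\{x\in A\mid h_{\mathbf{v}}(x)\le t\}$. $\widetilde{\mathrm{PH}}_0(A,\mathbf{v})$ is the persistence module $(\{\widetilde{H}_0(A_{\mathbf{v},t})\}_{t\in\mathbb{R}},\{\iota_s^t\}_{s\le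 t})$ with $\iota_s^t$ induced by inclusion (sending the component of $x$ in $A_{\mathbf{v},s}$ to the component of $x$ in $A_{\mathbf{v},t}$). An isomorphism of persistence modules is a family of linear isomorphisms, one for each $t\in\mathbb{R}$, commuting with the structure maps. *)

theory Defs
  imports "HOL-Analysis.Analysis" "HOL-Library.Poly_Mapping"
begin

section \<open>Persistence modules\<close>

text \<open>
  The vector spaces of a persistence module are linear subspaces \<open>pm_space P t\<close> of one ambient
  vector space (the type \<open>'v\<close> with scalar multiplication \<open>pm_scale P\<close>). The values of
  \<open>pm_map P s t\<close> matter only for \<open>s \<le> t\<close> and on \<open>pm_space P s\<close>.
\<close>

record ('k, 'v) pmod =
  pm_scale :: "'k \<Rightarrow> 'v \<Rightarrow> 'v"
  pm_space :: "real \<Rightarrow> 'v set"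
  pm_map :: "real \<Rightarrow> real \<Rightarrow> 'v \<Rightarrow> 'v"

definition linear_between ::
  "('k \<Rightarrow> 'v \<Rightarrow> 'v) \<Rightarrow> 'v set \<Rightarrow> ('k \<Rightarrow> 'w \<Rightarrow> 'w) \<Rightarrow> 'w set \<Rightarrow>
    ('v::ab_group_add \<Rightarrow> 'w::ab_group_add) \<Rightarrow> bool"
  where "linear_between sV V sW W f \<longleftrightarrow>
    f ` V \<subseteq> W \<and> (\<forall>x\<in>V. \<forall>y\<in>V. f (x + y) = f x + f y) \<and> (\<forall>a. \<forall>x\<in>V. f (sV a x) = sW a (f x))"

definition persistence_module :: "('k::field, 'v::ab_group_add) pmod \<Rightarrow> bool"
  where "persistence_module P \<longleftrightarrow>
    vector_space (pm_scale P) \<and>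
    (\<forall>t. module.subspace (pm_scale P) (pm_space P t)) \<and>
    (\<forall>s t. s \<le> t \<longrightarrow>
      linear_between (pm_scale P) (pm_space P s) (pm_scale P) (pm_space P t) (pm_map P s t)) \<and>
    (\<forall>t. \<forall>x\<in>pm_space P t. pm_map P t t x = x) \<and>
    (\<forall>r s t. r \<le> s \<longrightarrow> s \<le> t \<longrightarrow>
      (\<forall>x\<in>pm_space P r. pm_map P s t (pm_map P r s x) = pm_map P r t x))"

definition pm_iso ::
  "('k::field, 'v::ab_group_add) pmod \<Rightarrow> ('k, 'w::ab_group_add) pmod \<Rightarrow> (real \<Rightarrow> 'v \<Rightarrow> 'w) \<Rightarrow> bool"
  where "pm_iso P Q \<phi> \<longleftrightarrow>
    (\<forall>t. linear_between (pm_scale P) (pm_space P t) (pm_scale Q) (pm_space Q t) (\<phi> t) \<and>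
         bij_betw (\<phi> t) (pm_space P t) (pm_space Q t)) \<and>
    (\<forall>s t. s \<le> t \<longrightarrow> (\<forall>x\<in>pm_space P s. \<phi> t (pm_map P s t x) = pm_map Q s t (\<phi> s x)))"

definition pm_isomorphic ::
  "('k::field, 'v::ab_group_add) pmod \<Rightarrow> ('k, 'w::ab_group_add) pmod \<Rightarrow> bool"
  where "pm_isomorphic P Q \<longleftrightarrow> (\<exists>\<phi>. pm_iso P Q \<phi>)"

text \<open>
  Elements of the direct sum are finitely supported families; everything is componentwise.
\<close>

definition pm_direct_sum ::
  "'i set \<Rightarrow> ('i \<Rightarrow> ('k, 'v::ab_group_add) pmod) \<Rightarrow> ('k, 'i \<Rightarrow>\<^sub>0 'v) pmod"
  where "pm_direct_sum I P = \<lparr>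
    pm_scale = (\<lambda>a. Poly_Mapping.mapp (\<lambda>i. pm_scale (P i) a)),
    pm_space = (\<lambda>t. {f. Poly_Mapping.keys f \<subseteq> I \<and>
                          (\<forall>i\<in>I. Poly_Mapping.lookup f i \<in> pm_space (P i) t)}),
    pm_map = (\<lambda>s t. Poly_Mapping.mapp (\<lambda>i. pm_map (P i) s t)) \<rparr>"

lemma lookup_mapp_zero:
  assumes "\<And>i. g i 0 = 0"
  shows "Poly_Mapping.lookup (Poly_Mapping.mapp g f) i = g i (Poly_Mapping.lookup f i)"
  using assms by (auto simp: lookup_mapp when_def in_keys_iff)

lemma pm_map_0:
  assumes "persistence_module P" "s \<le> t"
  shows "pm_map P s t 0 = 0"
proof -
  interpret vector_space "pm_scale P" using assms by (simp add: persistence_module_def)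
  have "0 \<in> pm_space P s" using assms by (auto simp: persistence_module_def subspace_0)
  then have "pm_map P s t (0 + 0) = pm_map P s t 0 + pm_map P s t 0"
    using assms unfolding persistence_module_def linear_between_def by blast
  then show ?thesis by simp
qed

lemma persistence_module_direct_sum:
  assumes P: "\<And>i. persistence_module (P i)"
  shows "persistence_module (pm_direct_sum I P)"
proof -
  have vs: "vector_space (pm_scale (P i))" for i
    using P by (simp add: persistence_module_def)
  have sub: "module.subspace (pm_scale (P i)) (pm_space (P i) t)" for i t
    using P by (simp add: persistence_module_def)
  have mod: "module (pm_scale (P i))" for i
    using vs by (simp add: module_iff_vector_space)
  have lsc: "Poly_Mapping.lookup (Poly_Mapping.mapp (\<lambda>i. pm_scale (P i) a) f) i =
      pm_scale (P i) a (Poly_Mapping.lookup f i)" for a f i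
    by (rule lookup_mapp_zero) (simp add: module.scale_zero_right[OF mod])
  have lma: "Poly_Mapping.lookup (Poly_Mapping.mapp (\<lambda>i. pm_map (P i) s t) f) i =
      pm_map (P i) s t (Poly_Mapping.lookup f i)" if "s \<le> t" for s t f i
    by (rule lookup_mapp_zero) (simp add: pm_map_0[OF P that])
  have vsD: "vector_space (pm_scale (pm_direct_sum I P))"
    unfolding vector_space_def pm_direct_sum_def
    by (auto intro!: poly_mapping_eqI simp: lsc lookup_add
        module.scale_right_distrib[OF mod] module.scale_left_distrib[OF mod]
        module.scale_scale[OF mod] module.scale_one[OF mod])
  have in0: "Poly_Mapping.lookup f i \<in> pm_space (P i) t"
    if "f \<in> pm_space (pm_direct_sum I P) t" for f i t
  proof (cases "i \<in> I")
    case False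
    then have "Poly_Mapping.lookup f i = 0"
      using that by (auto simp: pm_direct_sum_def in_keys_iff)
    then show ?thesis using module.subspace_0[OF mod sub] by simp
  qed (use that in \<open>auto simp: pm_direct_sum_def\<close>)
  have keys: "Poly_Mapping.lookup f i = 0" if "f \<in> pm_space (pm_direct_sum I P) t" "i \<notin> I" for f i t
    using that by (auto simp: pm_direct_sum_def in_keys_iff)
  have inI: "f \<in> pm_space (pm_direct_sum I P) t"
    if "\<And>i. Poly_Mapping.lookup f i \<in> pm_space (P i) t"
       "\<And>i. i \<notin> I \<Longrightarrow> Poly_Mapping.lookup f i = 0" for f t
    using that by (auto simp: pm_direct_sum_def in_keys_iff)
  have sc: "pm_scale (pm_direct_sum I P) = (\<lambda>a. Poly_Mapping.mapp (\<lambda>i. pm_scale (P i) a))"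
    and ma: "pm_map (pm_direct_sum I P) = (\<lambda>s t. Poly_Mapping.mapp (\<lambda>i. pm_map (P i) s t))"
    by (simp_all add: pm_direct_sum_def)
  have modD: "module (pm_scale (pm_direct_sum I P))"
    using vsD by (simp add: module_iff_vector_space)
  have maps: "pm_map (P i) s t x \<in> pm_space (P i) t"
    and add: "y \<in> pm_space (P i) s \<Longrightarrow> pm_map (P i) s t (x + y) = pm_map (P i) s t x + pm_map (P i) s t y"
    and scl: "pm_map (P i) s t (pm_scale (P i) a x) = pm_scale (P i) a (pm_map (P i) s t x)"
    if "s \<le> t" "x \<in> pm_space (P i) s" for s t i x y a
    using P[of i] that unfolding persistence_module_def linear_between_def by (meson image_subset_iff)+
  have padd: "y \<in> pm_space (P i) t \<Longrightarrow> x + y \<in> pm_space (P i) t"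
    and pscl: "pm_scale (P i) a x \<in> pm_space (P i) t"
    if "x \<in> pm_space (P i) t" for x y a i t
    using that module.subspace_add[OF mod sub] module.subspace_scale[OF mod sub] by blast+
  have "module.subspace (pm_scale (pm_direct_sum I P)) (pm_space (pm_direct_sum I P) t)" for t
    unfolding module.subspace_def[OF modD]
  proof (intro conjI ballI allI)
    show "0 \<in> pm_space (pm_direct_sum I P) t"
      by (rule inI) (simp_all add: module.subspace_0[OF mod sub])
  next
    fix x y assume xy: "x \<in> pm_space (pm_direct_sum I P) t" "y \<in> pm_space (pm_direct_sum I P) t"
    show "x + y \<in> pm_space (pm_direct_sum I P) t"
      by (rule inI) (simp_all add: lookup_add padd in0[OF xy(1)] in0[OF xy(2)] keys[OF xy(1)] keys[OF xy(2)])
  next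
    fix a x assume x: "x \<in> pm_space (pm_direct_sum I P) t"
    show "pm_scale (pm_direct_sum I P) a x \<in> pm_space (pm_direct_sum I P) t"
      unfolding sc by (rule inI)
        (simp_all add: lsc pscl in0[OF x] keys[OF x] module.scale_zero_right[OF mod])
  qed
  moreover have "linear_between (pm_scale (pm_direct_sum I P)) (pm_space (pm_direct_sum I P) s)
      (pm_scale (pm_direct_sum I P)) (pm_space (pm_direct_sum I P) t) (pm_map (pm_direct_sum I P) s t)"
    if st: "s \<le> t" for s t
    unfolding linear_between_def
  proof (intro conjI ballI allI image_subsetI)
    fix x assume x: "x \<in> pm_space (pm_direct_sum I P) s"
    show "pm_map (pm_direct_sum I P) s t x \<in> pm_space (pm_direct_sum I P) t"
      unfolding ma by (rule inI)
        (simp_all add: lma[OF st] maps[OF st in0[OF x]] keys[OF x] pm_map_0[OF P st])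
  next
    fix x y assume xy: "x \<in> pm_space (pm_direct_sum I P) s" "y \<in> pm_space (pm_direct_sum I P) s"
    show "pm_map (pm_direct_sum I P) s t (x + y) =
        pm_map (pm_direct_sum I P) s t x + pm_map (pm_direct_sum I P) s t y"
      unfolding ma by (rule poly_mapping_eqI)
        (simp add: lma[OF st] lookup_add add[OF st in0[OF xy(1)] in0[OF xy(2)]])
  next
    fix a x assume x: "x \<in> pm_space (pm_direct_sum I P) s"
    show "pm_map (pm_direct_sum I P) s t (pm_scale (pm_direct_sum I P) a x) =
        pm_scale (pm_direct_sum I P) a (pm_map (pm_direct_sum I P) s t x)"
      unfolding ma sc by (rule poly_mapping_eqI)
        (simp add: lma[OF st] lsc scl[OF st in0[OF x]])
  qed
  moreover have "pm_map (pm_direct_sum I P) t t x = x" if "x \<in> pm_space (pm_direct_sum I P) t" for t x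
    using in0[OF that] P unfolding ma persistence_module_def
    by (intro poly_mapping_eqI) (simp add: lma)
  moreover have "pm_map (pm_direct_sum I P) s t (pm_map (pm_direct_sum I P) r s x) =
      pm_map (pm_direct_sum I P) r t x"
    if "r \<le> s" "s \<le> t" "x \<in> pm_space (pm_direct_sum I P) r" for r s t x
  proof -
    have "pm_map (P i) s t (pm_map (P i) r s (Poly_Mapping.lookup x i)) =
        pm_map (P i) r t (Poly_Mapping.lookup x i)" for i
      using in0[OF that(3), of i] P[of i] that(1,2) unfolding persistence_module_def by blast
    then show ?thesis using that unfolding ma by (intro poly_mapping_eqI) (simp add: lma)
  qed
  ultimately show ?thesis using vsD unfolding persistence_module_def by blast
qed

section \<open>Reduced degree-zero homology of sublevel sets\<close>

definition sublevel :: "'a::real_inner set \<Rightarrow> 'a \<Rightarrow> real \<Rightarrow> 'a set"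
  where "sublevel A v t = {x \<in> A. x \<bullet> v \<le> t}"

text \<open>
  A formal linear combination of connected components is a finitely supported function on sets
  whose support consists of components of \<open>A\<close>.
\<close>

definition red_H0 :: "'a::topological_space set \<Rightarrow> ('a set \<Rightarrow>\<^sub>0 'f::field) set"
  where "red_H0 A = {f. Poly_Mapping.keys f \<subseteq> components A \<and>
                        (\<Sum>C\<in>Poly_Mapping.keys f. Poly_Mapping.lookup f C) = 0}"

text \<open>
  For \<open>A \<subseteq> B\<close> and a component \<open>C\<close> of \<open>A\<close>, all points of \<open>C\<close> have the same component in \<open>B\<close>, so
  the union below is that component (see \<open>comp_image_component\<close>).
\<close>

definition comp_image :: "'a::topological_space set \<Rightarrow> 'a set \<Rightarrow> 'a set"
  where "comp_image B C = (\<Union>x\<in>C. connected_component_set B x)"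

definition H0_map :: "'a::topological_space set \<Rightarrow> ('a set \<Rightarrow>\<^sub>0 'f::field) \<Rightarrow> ('a set \<Rightarrow>\<^sub>0 'f)"
  where "H0_map B f =
    (\<Sum>C\<in>Poly_Mapping.keys f. Poly_Mapping.single (comp_image B C) (Poly_Mapping.lookup f C))"

definition red_PH0 :: "'a::real_inner set \<Rightarrow> 'a \<Rightarrow> ('f::field, 'a set \<Rightarrow>\<^sub>0 'f) pmod"
  where "red_PH0 A v = \<lparr>
    pm_scale = (\<lambda>a. Poly_Mapping.map ((*) a)),
    pm_space = (\<lambda>t. red_H0 (sublevel A v t)),
    pm_map = (\<lambda>s t. H0_map (sublevel A v t)) \<rparr>"

lemma comp_image_component:
  assumes "A \<subseteq> B" "x \<in> A"
  shows "comp_image B (connected_component_set A x) = connected_component_set B x"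
proof -
  have "connected_component_set B y = connected_component_set B x"
    if "connected_component A x y" for y
    using connected_component_eq[of y B x] connected_component_of_subset[OF that assms(1)] by simp
  moreover have "x \<in> connected_component_set A x"
    using assms(2) by simp
  ultimately show ?thesis
    unfolding comp_image_def by blast
qed

lemma comp_image_in_components:
  assumes "A \<subseteq> B" "C \<in> components A"
  shows "comp_image B C \<in> components B"
proof -
  obtain x where "x \<in> A" "C = connected_component_set A x"
    using assms(2) unfolding components_def by blast
  then show ?thesis
    using comp_image_component[OF assms(1)] assms(1) unfolding components_def by auto
qed

lemma H0_map_superset:
  assumes "finite K" "Poly_Mapping.keys f \<subseteq> K"
  shows "H0_map B f = (\<Sum>C\<in>K. Poly_Mapping.single (comp_image B C) (Poly_Mapping.lookup f C))"
  unfolding H0_map_def using assms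
  by (intro sum.mono_neutral_left) (auto simp: in_keys_iff)

lemma coeff_sum_superset:
  assumes "finite K" "Poly_Mapping.keys f \<subseteq> K"
  shows "(\<Sum>C\<in>Poly_Mapping.keys f. Poly_Mapping.lookup f C) = (\<Sum>C\<in>K. Poly_Mapping.lookup f C)"
  using assms by (intro sum.mono_neutral_left) (auto simp: in_keys_iff)

lemma H0_map_add: "H0_map B (f + g) = H0_map B f + H0_map B g"
proof -
  let ?K = "Poly_Mapping.keys f \<union> Poly_Mapping.keys g"
  have "Poly_Mapping.keys (f + g) \<subseteq> ?K" by (rule Poly_Mapping.keys_add)
  then have "H0_map B h = (\<Sum>C\<in>?K. Poly_Mapping.single (comp_image B C) (Poly_Mapping.lookup h C))"
    if "h \<in> {f, g, f + g}" for h
    using that by (intro H0_map_superset) auto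
  then show ?thesis by (simp add: lookup_add single_add sum.distrib)
qed

lemma H0_map_sum: "H0_map B (sum F S) = (\<Sum>i\<in>S. H0_map B (F i))"
proof (induction S rule: infinite_finite_induct)
  case empty
  show ?case by (simp add: H0_map_def)
next
  case (infinite S)
  then show ?case by (simp add: H0_map_def)
qed (simp add: H0_map_add)

lemma H0_map_single: "H0_map B (Poly_Mapping.single C a) = Poly_Mapping.single (comp_image B C) a"
  by (cases "a = 0") (simp_all add: H0_map_def)

lemma lookup_scale:
  "Poly_Mapping.lookup (Poly_Mapping.map ((*) a) f) C = a * Poly_Mapping.lookup f C" for a :: "'f::field"
  by (auto simp: Poly_Mapping.map.rep_eq when_def)

lemma H0_map_scale: "H0_map B (Poly_Mapping.map ((*) a) f) = Poly_Mapping.map ((*) a) (H0_map B f)"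
proof (rule poly_mapping_eqI)
  fix D
  have "Poly_Mapping.keys (Poly_Mapping.map ((*) a) f) \<subseteq> Poly_Mapping.keys f"
    by (auto simp: in_keys_iff lookup_scale)
  then have "H0_map B (Poly_Mapping.map ((*) a) f) = (\<Sum>C\<in>Poly_Mapping.keys f.
      Poly_Mapping.single (comp_image B C) (a * Poly_Mapping.lookup f C))"
    by (simp only: H0_map_superset[OF finite_keys] lookup_scale)
  then have "Poly_Mapping.lookup (H0_map B (Poly_Mapping.map ((*) a) f)) D = (\<Sum>C\<in>Poly_Mapping.keys f.
      a * Poly_Mapping.lookup (Poly_Mapping.single (comp_image B C) (Poly_Mapping.lookup f C)) D)"
    by (simp add: lookup_sum lookup_single when_def if_distrib cong: if_cong)
  then show "Poly_Mapping.lookup (H0_map B (Poly_Mapping.map ((*) a) f)) D =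
      Poly_Mapping.lookup (Poly_Mapping.map ((*) a) (H0_map B f)) D"
    by (simp only: lookup_scale H0_map_def[of B f] lookup_sum sum_distrib_left)
qed

definition coeff_sum :: "('b \<Rightarrow>\<^sub>0 'f::field) \<Rightarrow> 'f"
  where "coeff_sum f = (\<Sum>C\<in>Poly_Mapping.keys f. Poly_Mapping.lookup f C)"

lemma coeff_sum_add: "coeff_sum (f + g) = coeff_sum f + coeff_sum g"
proof -
  let ?K = "Poly_Mapping.keys f \<union> Poly_Mapping.keys g"
  have "Poly_Mapping.keys (f + g) \<subseteq> ?K" by (rule Poly_Mapping.keys_add)
  then have "coeff_sum h = (\<Sum>C\<in>?K. Poly_Mapping.lookup h C)" if "h \<in> {f, g, f + g}" for h
    unfolding coeff_sum_def using that by (intro coeff_sum_superset) auto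
  then show ?thesis by (simp add: lookup_add sum.distrib)
qed

lemma coeff_sum_sum: "coeff_sum (sum F S) = (\<Sum>i\<in>S. coeff_sum (F i))"
proof (induction S rule: infinite_finite_induct)
  case empty
  show ?case by (simp add: coeff_sum_def)
next
  case (infinite S)
  then show ?case by (simp add: coeff_sum_def)
qed (simp add: coeff_sum_add)

lemma coeff_sum_single: "coeff_sum (Poly_Mapping.single C a) = a"
  by (cases "a = 0") (simp_all add: coeff_sum_def)

lemma coeff_sum_H0_map: "coeff_sum (H0_map B f) = coeff_sum f"
  by (simp only: H0_map_def coeff_sum_sum coeff_sum_single) (simp only: coeff_sum_def)

lemma coeff_sum_scale: "coeff_sum (Poly_Mapping.map ((*) a) f) = a * coeff_sum f"
proof -
  have "Poly_Mapping.keys (Poly_Mapping.map ((*) a) f) \<subseteq> Poly_Mapping.keys f"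
    by (auto simp: in_keys_iff lookup_scale)
  then show ?thesis
    unfolding coeff_sum_def
    by (simp only: coeff_sum_superset[OF finite_keys] lookup_scale sum_distrib_left)
qed

lemma keys_H0_map: "Poly_Mapping.keys (H0_map B f) \<subseteq> comp_image B ` Poly_Mapping.keys f"
proof
  fix D assume "D \<in> Poly_Mapping.keys (H0_map B f)"
  then have "(\<Sum>C\<in>Poly_Mapping.keys f.
      Poly_Mapping.lookup (Poly_Mapping.single (comp_image B C) (Poly_Mapping.lookup f C)) D) \<noteq> 0"
    by (simp add: H0_map_def in_keys_iff lookup_sum)
  then obtain C where "C \<in> Poly_Mapping.keys f"
    "Poly_Mapping.lookup (Poly_Mapping.single (comp_image B C) (Poly_Mapping.lookup f C)) D \<noteq> 0"
    by (meson sum.neutral)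
  then show "D \<in> comp_image B ` Poly_Mapping.keys f"
    by (auto simp: lookup_single when_def split: if_splits)
qed

lemma persistence_module_red_PH0:
  fixes A :: "'a::real_inner set"
  shows "persistence_module (red_PH0 A v :: ('f::field, 'a set \<Rightarrow>\<^sub>0 'f) pmod)"
proof -
  let ?sc = "\<lambda>a. Poly_Mapping.map ((*) a) :: ('a set \<Rightarrow>\<^sub>0 'f) \<Rightarrow> _"
  have H: "red_H0 S = {f. Poly_Mapping.keys f \<subseteq> components S \<and> coeff_sum f = 0}" for S :: "'a set"
    by (simp add: red_H0_def coeff_sum_def)
  have vs: "vector_space ?sc"
    by unfold_locales (auto intro!: poly_mapping_eqI simp: lookup_scale lookup_add algebra_simps)
  then have mod: "module ?sc" by (simp add: module_iff_vector_space)
  have mono: "sublevel A v s \<subseteq> sublevel A v t" if "s \<le> t" for s t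
    using that by (auto simp: sublevel_def)
  have ksc: "Poly_Mapping.keys (?sc a f) \<subseteq> Poly_Mapping.keys f" for a f
    by (auto simp: in_keys_iff lookup_scale)
  have sub: "module.subspace ?sc (red_H0 S)" for S :: "'a set"
    unfolding module.subspace_def[OF mod] H
  proof (intro conjI ballI allI)
    show "0 \<in> {f. Poly_Mapping.keys f \<subseteq> components S \<and> coeff_sum f = 0}"
      by (simp add: coeff_sum_def)
  next
    fix f g :: "'a set \<Rightarrow>\<^sub>0 'f"
    assume "f \<in> {f. Poly_Mapping.keys f \<subseteq> components S \<and> coeff_sum f = 0}"
      "g \<in> {f. Poly_Mapping.keys f \<subseteq> components S \<and> coeff_sum f = 0}"
    then show "f + g \<in> {f. Poly_Mapping.keys f \<subseteq> components S \<and> coeff_sum f = 0}"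
      using Poly_Mapping.keys_add[of f g] by (auto simp: coeff_sum_add)
  next
    fix a and f :: "'a set \<Rightarrow>\<^sub>0 'f"
    assume "f \<in> {f. Poly_Mapping.keys f \<subseteq> components S \<and> coeff_sum f = 0}"
    then show "?sc a f \<in> {f. Poly_Mapping.keys f \<subseteq> components S \<and> coeff_sum f = 0}"
      using ksc[of a f] by (auto simp: coeff_sum_scale)
  qed
  have maps: "H0_map (sublevel A v t) f \<in> red_H0 (sublevel A v t)"
    if "s \<le> t" "f \<in> red_H0 (sublevel A v s)" for s t and f :: "'a set \<Rightarrow>\<^sub>0 'f"
    using that keys_H0_map[of "sublevel A v t" f] comp_image_in_components[OF mono[OF that(1)]]
    by (auto simp: H coeff_sum_H0_map subset_iff image_iff)
  have comp: "comp_image (sublevel A v t) (comp_image (sublevel A v s) C) = comp_image (sublevel A v t) C"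
    if rs: "r \<le> s" "s \<le> t" and C: "C \<in> components (sublevel A v r)" for r s t C
  proof -
    obtain x where x: "x \<in> sublevel A v r" "C = connected_component_set (sublevel A v r) x"
      using C by (auto simp: components_def)
    then have "x \<in> sublevel A v s" using mono rs by blast
    then show ?thesis
      using x rs by (simp add: comp_image_component mono)
  qed
  have self: "comp_image S C = C" if C: "C \<in> components S" for S C :: "'a set"
    using C comp_image_component[of S S] by (auto simp: components_def)
  have sums: "(\<Sum>C\<in>Poly_Mapping.keys f. Poly_Mapping.single C (Poly_Mapping.lookup f C)) = f"
    for f :: "'a set \<Rightarrow>\<^sub>0 'f"
    by (intro poly_mapping_eqI)
      (auto simp: lookup_sum lookup_single when_def in_keys_iff sum.delta)
  have ident: "H0_map S f = f" if "f \<in> red_H0 S" for S :: "'a set" and f :: "'a set \<Rightarrow>\<^sub>0 'f"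
  proof -
    have "H0_map S f = (\<Sum>C\<in>Poly_Mapping.keys f. Poly_Mapping.single C (Poly_Mapping.lookup f C))"
      unfolding H0_map_def using that by (intro sum.cong) (auto simp: red_H0_def self subset_iff)
    then show ?thesis by (simp add: sums)
  qed
  have funct: "H0_map (sublevel A v t) (H0_map (sublevel A v s) f) = H0_map (sublevel A v t) f"
    if "r \<le> s" "s \<le> t" "f \<in> red_H0 (sublevel A v r)" for r s t and f :: "'a set \<Rightarrow>\<^sub>0 'f"
  proof -
    have "H0_map (sublevel A v t) (H0_map (sublevel A v s) f) =
        (\<Sum>C\<in>Poly_Mapping.keys f. Poly_Mapping.single
          (comp_image (sublevel A v t) (comp_image (sublevel A v s) C)) (Poly_Mapping.lookup f C))"
      unfolding H0_map_def[of "sublevel A v s"] by (simp add: H0_map_sum H0_map_single)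
    also have "\<dots> = H0_map (sublevel A v t) f"
      unfolding H0_map_def using that by (intro sum.cong) (auto simp: red_H0_def comp subset_iff)
    finally show ?thesis .
  qed
  show ?thesis
    unfolding persistence_module_def linear_between_def red_PH0_def pmod.simps
    using vs sub maps ident funct
    by (intro conjI allI impI ballI) (auto simp: H0_map_add H0_map_scale)
qed

section \<open>Star-shaped sets and their sectors\<close>

definition star_center :: "'a::real_vector set \<Rightarrow> 'a \<Rightarrow> bool"
  where "star_center M c \<longleftrightarrow> c \<in> M \<and> (\<forall>x\<in>M. closed_segment c x \<subseteq> M)"

lemma starlike_iff_star_center: "starlike M \<longleftrightarrow> (\<exists>c. star_center M c)"
  by (auto simp: starlike_def star_center_def)

text \<open>
  The vertices are \<open>x 0, \<dots>, x m\<close>, without repetition; consecutive ones (cyclically) span an edge,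
  that is, a one-dimensional face.
\<close>

definition cyclic_vertices :: "'a::euclidean_space set \<Rightarrow> nat \<Rightarrow> (nat \<Rightarrow> 'a) \<Rightarrow> bool"
  where "cyclic_vertices P m x \<longleftrightarrow>
    bij_betw x {0..m} {p. p extreme_point_of P} \<and>
    (\<forall>i\<in>{0..m}. closed_segment (x i) (x ((i + 1) mod (m + 1))) edge_of P)"

definition sector :: "'a::real_vector set \<Rightarrow> 'a \<Rightarrow> nat \<Rightarrow> (nat \<Rightarrow> 'a) \<Rightarrow> nat \<Rightarrow> 'a set"
  where "sector M c m x i = convex hull {x i, x ((i + 1) mod (m + 1)), c} \<inter> M"

end

theory Submission
  imports Defs
begin

text \<open>
  The isomorphism is the sum of the maps induced by the inclusions of the sectors. That it commutes
  with the structure maps is formal (\<open>pm_isomorphic_glue\<close>); what has to be shown is that it is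
  bijective at every level \<open>t\<close>. Call the segment from the center to a vertex of the hull a spoke. If the
  center has height at most \<open>t\<close>, all sublevel sets are star-shaped and all reduced homology vanishes. If
  it is higher, the sectors that reach down to level \<open>t\<close> form a row, not a cycle, in which neighbours
  are glued along a piece of a spoke: each gluing merges one component of the one side with one of the
  other, and this is what passing to reduced homology accounts for. The proof replaces such a count by
  two statements that do not refer to the order of the sectors and that allow infinitely many
  components.

  Surjectivity (\<open>glue_surj\<close>, \<open>sector_chain\<close>): any two points of the sublevel set \<open>M\<^sub>t\<close> are joined by a
  chain of points in which consecutive points lie in a common sector, because the sublevel set of the
  convex hull is connected and the triangles that cover it overlap only inside \<open>M\<close>. So the difference
  of two components of \<open>M\<^sub>t\<close> telescopes into differences that live in sectors.

  Injectivity (\<open>glue_inj\<close>, \<open>sector_retraction\<close>): for each sector that reaches down to level \<open>t\<close>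
  there is a continuous map from \<open>M\<^sub>t\<close> into the sublevel set of the sector which keeps its components
  and sends every other sector into a single component. On reduced homology it annihilates the other summands and is the identity on its own,
  so the summands are independent. If the center is in \<open>M\<^sub>t\<close> the constant map will do. Otherwise
  one projects radially from the center onto the line of height \<open>t\<close>, and then to the nearest point of the
  segment that the line has in common with the triangle of the sector.

  Both parts rest on planar convex geometry: the triangles over the edges cover the polygon
  (\<open>polygon_covered\<close>), distinct triangles meet only in spokes (\<open>triangles_meet_in_spokes\<close>), and
  a path in the polygon leaves a triangle only through its spokes (\<open>exit_triangle_through_spoke\<close>).
  The spokes belong to \<open>M\<close> since the vertices of the hull do.
\<close>

section \<open>Linear functionals on formal sums of components\<close>

definition pairing :: "('b \<Rightarrow> 'f) \<Rightarrow> ('b \<Rightarrow>\<^sub>0 'f::field) \<Rightarrow> 'f"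
  where "pairing \<omega> f = (\<Sum>C\<in>Poly_Mapping.keys f. Poly_Mapping.lookup f C * \<omega> C)"

lemma pairing_superset:
  assumes "finite K" "Poly_Mapping.keys f \<subseteq> K"
  shows "pairing \<omega> f = (\<Sum>C\<in>K. Poly_Mapping.lookup f C * \<omega> C)"
  unfolding pairing_def using assms by (intro sum.mono_neutral_left) (auto simp: in_keys_iff)

lemma pairing_add: "pairing \<omega> (f + g) = pairing \<omega> f + pairing \<omega> g"
proof -
  let ?K = "Poly_Mapping.keys f \<union> Poly_Mapping.keys g"
  have "pairing \<omega> h = (\<Sum>C\<in>?K. Poly_Mapping.lookup h C * \<omega> C)" if "h \<in> {f, g, f + g}" for h
    using that Poly_Mapping.keys_add[of f g] by (intro pairing_superset) auto
  then show ?thesis by (simp add: lookup_add distrib_right sum.distrib)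
qed

lemma pairing_sum: "pairing \<omega> (sum F S) = (\<Sum>i\<in>S. pairing \<omega> (F i))"
  by (induction S rule: infinite_finite_induct) (simp_all add: pairing_add, simp_all add: pairing_def)

lemma pairing_single: "pairing \<omega> (Poly_Mapping.single C a) = a * \<omega> C"
  by (cases "a = 0") (simp_all add: pairing_def)

lemma pairing_H0_map: "pairing \<omega> (H0_map B f) = pairing (\<lambda>C. \<omega> (comp_image B C)) f"
  by (simp add: H0_map_def pairing_sum pairing_single) (simp add: pairing_def)

lemma pairing_const_on_keys:
  assumes "\<And>C. C \<in> Poly_Mapping.keys f \<Longrightarrow> \<omega> C = k" and "coeff_sum f = 0"
  shows "pairing \<omega> f = 0"
proof -
  have "pairing \<omega> f = coeff_sum f * k"
    using assms(1) by (simp add: pairing_def coeff_sum_def sum_distrib_right)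
  then show ?thesis using assms(2) by simp
qed

lemma pairing_indicator:
  assumes "\<And>C. C \<in> Poly_Mapping.keys f \<Longrightarrow> \<omega> C = (if C = D then 1 else 0)"
  shows "pairing \<omega> f = Poly_Mapping.lookup f D"
proof -
  have "pairing \<omega> f = (\<Sum>C\<in>Poly_Mapping.keys f. if C = D then Poly_Mapping.lookup f C else 0)"
    unfolding pairing_def using assms by (intro sum.cong) auto
  then show ?thesis by (auto simp: in_keys_iff)
qed

section \<open>Reduced homology of a set glued from pieces\<close>

lemma red_H0_iff: "f \<in> red_H0 A \<longleftrightarrow> Poly_Mapping.keys f \<subseteq> components A \<and> coeff_sum f = 0"
  by (simp add: red_H0_def coeff_sum_def)

lemma zero_in_red_H0: "0 \<in> red_H0 A"
  by (simp add: red_H0_iff coeff_sum_def)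

lemma red_H0_add: "f \<in> red_H0 A \<Longrightarrow> g \<in> red_H0 A \<Longrightarrow> f + g \<in> red_H0 A"
  using Poly_Mapping.keys_add[of f g] by (auto simp: red_H0_iff coeff_sum_add)

lemma red_H0_sum: "(\<And>i. i \<in> S \<Longrightarrow> F i \<in> red_H0 A) \<Longrightarrow> sum F S \<in> red_H0 A"
  by (induction S rule: infinite_finite_induct) (simp_all add: zero_in_red_H0 red_H0_add)

lemma H0_map_in_red_H0:
  assumes "A \<subseteq> B" "f \<in> red_H0 A"
  shows "H0_map B f \<in> red_H0 B"
  using assms keys_H0_map[of B f] comp_image_in_components[OF assms(1)]
  by (auto simp: red_H0_iff coeff_sum_H0_map subset_iff image_iff)

lemma H0_map_H0_map:
  assumes "A \<subseteq> B" "B \<subseteq> C" "f \<in> red_H0 A"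
  shows "H0_map C (H0_map B f) = H0_map C f"
proof -
  have "comp_image C (comp_image B D) = comp_image C D" if "D \<in> components A" for D
  proof -
    from that obtain x where "x \<in> A" "D = connected_component_set A x"
      by (auto simp: components_def)
    with assms(1,2) show ?thesis
      by (simp add: comp_image_component subset_iff)
  qed
  then show ?thesis
    using assms(3) unfolding H0_map_def[of B] H0_map_sum H0_map_single
    by (auto simp: H0_map_def red_H0_iff subset_iff intro!: sum.cong)
qed

lemma component_difference_in_red_H0:
  assumes "p \<in> A" "q \<in> A"
  shows "Poly_Mapping.single (connected_component_set A p) a +
    Poly_Mapping.single (connected_component_set A q) (- a) \<in> red_H0 A"
  using assms
  by (intro conjI red_H0_iff[THEN iffD2] order_trans[OF Poly_Mapping.keys_add])
     (auto simp: componentsI coeff_sum_add coeff_sum_single)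

definition glue :: "'b set \<Rightarrow> 'a::topological_space set \<Rightarrow>
    ('b \<Rightarrow>\<^sub>0 'a set \<Rightarrow>\<^sub>0 'f::field) \<Rightarrow> 'a set \<Rightarrow>\<^sub>0 'f"
  where "glue I X f = (\<Sum>i\<in>I. H0_map X (Poly_Mapping.lookup f i))"

lemma glue_add: "glue I X (f + g) = glue I X f + glue I X g"
  by (simp add: glue_def lookup_add H0_map_add sum.distrib)

definition share_piece :: "'b set \<Rightarrow> ('b \<Rightarrow> 'a set) \<Rightarrow> ('a \<times> 'a) set"
  where "share_piece I Y = {(p, q). \<exists>i\<in>I. p \<in> Y i \<and> q \<in> Y i}"

text \<open>
  Only the effect on components matters, so \<open>r\<close> need not fix \<open>Y i\<close> pointwise: it has to keep every
  point of \<open>Y i\<close> in its component. The last condition says that each of the other pieces, although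
  possibly disconnected, becomes trivial in reduced homology.
\<close>

definition retracts_onto_piece ::
  "'b set \<Rightarrow> 'a::topological_space set \<Rightarrow> ('b \<Rightarrow> 'a set) \<Rightarrow> 'b \<Rightarrow> ('a \<Rightarrow> 'a) \<Rightarrow> bool"
  where "retracts_onto_piece I X Y i r \<longleftrightarrow> continuous_on X r \<and> r ` X \<subseteq> Y i \<and>
    (\<forall>p\<in>Y i. connected_component (Y i) p (r p)) \<and>
    (\<forall>j\<in>I - {i}. \<forall>p\<in>Y j. \<forall>q\<in>Y j. connected_component (Y i) (r p) (r q))"

definition red_H0_family :: "'b set \<Rightarrow> ('b \<Rightarrow> 'a::topological_space set) \<Rightarrow>
    ('b \<Rightarrow>\<^sub>0 'a set \<Rightarrow>\<^sub>0 'f::field) set"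
  where "red_H0_family I Y =
    {f. Poly_Mapping.keys f \<subseteq> I \<and> (\<forall>i\<in>I. Poly_Mapping.lookup f i \<in> red_H0 (Y i))}"

lemma red_H0_family_add:
  "f \<in> red_H0_family I Y \<Longrightarrow> g \<in> red_H0_family I Y \<Longrightarrow> f + g \<in> red_H0_family I Y"
  using Poly_Mapping.keys_add[of f g]
  by (auto simp: red_H0_family_def lookup_add red_H0_add)

text \<open>
  Reduced homology is spanned by differences of components. Such a difference telescopes along a
  chain of points in which consecutive points share a piece, and each term of the telescope comes
  from that piece.
\<close>

lemma glue_surj:
  fixes Y :: "'b \<Rightarrow> 'a::topological_space set" and g :: "'a set \<Rightarrow>\<^sub>0 'f::field"
  assumes "finite I" and sub: "\<And>i. i \<in> I \<Longrightarrow> Y i \<subseteq> X"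
    and chain: "\<And>p q. p \<in> X \<Longrightarrow> q \<in> X \<Longrightarrow> (p, q) \<in> (share_piece I Y)\<^sup>*"
    and g: "g \<in> red_H0 X"
  shows "g \<in> glue I X ` red_H0_family I Y"
proof -
  let ?W = "glue I X ` (red_H0_family I Y :: ('b \<Rightarrow>\<^sub>0 'a set \<Rightarrow>\<^sub>0 'f) set)"
  let ?d = "\<lambda>a p q. Poly_Mapping.single (connected_component_set X p) (a::'f) +
    Poly_Mapping.single (connected_component_set X q) (- a)"
  have W0: "0 \<in> ?W"
    by (rule image_eqI[of _ _ 0])
       (auto simp: glue_def red_H0_family_def zero_in_red_H0 H0_map_def)
  have W_add: "u + w \<in> ?W" if "u \<in> ?W" "w \<in> ?W" for u w
    using that by (auto simp: glue_add[symmetric] intro!: imageI red_H0_family_add)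
  have W_sum: "sum F S \<in> ?W" if "\<And>C. C \<in> S \<Longrightarrow> F C \<in> ?W" for F and S :: "'a set set"
    using that by (induction S rule: infinite_finite_induct) (simp_all add: W0 W_add)
  have link: "?d a p q \<in> ?W" if i: "i \<in> I" "p \<in> Y i" "q \<in> Y i" for a p q i
  proof -
    let ?h = "Poly_Mapping.single (connected_component_set (Y i) p) a +
      Poly_Mapping.single (connected_component_set (Y i) q) (- a)"
    have "H0_map X ?h = ?d a p q"
      using i sub by (simp add: H0_map_add H0_map_single comp_image_component)
    moreover have "glue I X (Poly_Mapping.single i ?h) = H0_map X ?h"
    proof -
      have "glue I X (Poly_Mapping.single i ?h) = (\<Sum>j\<in>I. if j = i then H0_map X ?h else 0)"
        unfolding glue_def by (intro sum.cong) (auto simp: lookup_single when_def H0_map_def)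
      then show ?thesis using \<open>finite I\<close> i by simp
    qed
    moreover have "Poly_Mapping.single i ?h \<in> red_H0_family I Y"
      using i component_difference_in_red_H0[OF i(2,3)]
      by (auto simp: red_H0_family_def lookup_single when_def zero_in_red_H0)
    ultimately show ?thesis by (metis image_eqI)
  qed
  have dW: "?d a p q \<in> ?W" if "p \<in> X" "q \<in> X" for a p q
    using chain[OF that]
  proof (induction rule: rtrancl_induct)
    case base
    then show ?case using W0 by (simp flip: single_add)
  next
    case (step q r)
    then obtain i where "i \<in> I" "q \<in> Y i" "r \<in> Y i" by (auto simp: share_piece_def)
    then have "?d a p q + ?d a q r \<in> ?W"
      by (intro W_add[OF step.IH link])
    moreover have "?d a p q + ?d a q r = ?d a p r"
      by (simp add: algebra_simps flip: single_add)
    ultimately show ?case by simp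
  qed
  show ?thesis
  proof (cases "X = {}")
    case True
    then have "g = 0" using g by (simp add: red_H0_iff)
    then show ?thesis using W0 by simp
  next
    case False
    then obtain p where p: "p \<in> X" by blast
    let ?K = "Poly_Mapping.keys g" and ?a = "Poly_Mapping.lookup g"
    have rep: "\<exists>q\<in>X. C = connected_component_set X q" if "C \<in> ?K" for C
      using g that by (auto simp: red_H0_iff components_def)
    have "(\<Sum>C\<in>?K. Poly_Mapping.single C (?a C)) = g"
      by (intro poly_mapping_eqI) (auto simp: lookup_sum lookup_single when_def in_keys_iff)
    moreover have "(\<Sum>C\<in>?K. Poly_Mapping.single D (- ?a C)) = 0" for D
    proof -
      have "(\<Sum>C\<in>?K. Poly_Mapping.single D (- ?a C)) = Poly_Mapping.single D (- coeff_sum g)"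
        by (intro poly_mapping_eqI)
           (simp add: lookup_sum lookup_single when_def coeff_sum_def sum_negf)
      then show ?thesis using g by (simp add: red_H0_iff)
    qed
    ultimately have "g = (\<Sum>C\<in>?K. Poly_Mapping.single C (?a C) +
        Poly_Mapping.single (connected_component_set X p) (- ?a C))"
      by (simp add: sum.distrib)
    also have "\<dots> \<in> ?W"
      using rep dW p by (intro W_sum) metis
    finally show ?thesis .
  qed
qed

text \<open>
  Suppose that a family is mapped to zero. Applying the retraction onto the piece \<open>Y i\<close> kills the
  contributions of all other pieces, because each of them is sent into a single component of \<open>Y i\<close>
  and its coefficients sum to zero; the contribution of \<open>Y i\<close> itself is unchanged. Hence the
  \<open>i\<close>-th entry is zero. Instead of pushing formal sums forward along \<open>r\<close>, the proof reads off the
  coefficient of a component \<open>D\<close> of \<open>Y i\<close> with the functional that tests whether \<open>r\<close> maps a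
  component of \<open>X\<close> into \<open>D\<close>.
\<close>

lemma glue_inj:
  fixes Y :: "'b \<Rightarrow> 'a::topological_space set" and X
  assumes "finite I" and sub: "\<And>i. i \<in> I \<Longrightarrow> Y i \<subseteq> X"
    and retract: "\<And>i. i \<in> I \<Longrightarrow> Y i \<noteq> {} \<Longrightarrow> \<exists>r. retracts_onto_piece I X Y i r"
    and f: "f \<in> red_H0_family I Y" and 0: "glue I X f = (0 :: 'a set \<Rightarrow>\<^sub>0 'f::field)"
  shows "f = 0"
proof (rule poly_mapping_eqI)
  fix i
  have fr: "Poly_Mapping.lookup f j \<in> red_H0 (Y j)" if "j \<in> I" for j
    using f that by (simp add: red_H0_family_def)
  show "Poly_Mapping.lookup f i = Poly_Mapping.lookup 0 i"
  proof (cases "i \<in> I \<and> Y i \<noteq> {}")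
    case False
    then show ?thesis
      using f fr[of i] by (cases "i \<in> I") (auto simp: red_H0_family_def red_H0_iff in_keys_iff)
  next
    case True
    then have i: "i \<in> I" by simp
    obtain r where r: "continuous_on X r" "r ` X \<subseteq> Y i"
      and own: "\<And>p. p \<in> Y i \<Longrightarrow> connected_component (Y i) p (r p)"
      and other: "\<And>j p q. j \<in> I \<Longrightarrow> j \<noteq> i \<Longrightarrow> p \<in> Y j \<Longrightarrow> q \<in> Y j
        \<Longrightarrow> connected_component (Y i) (r p) (r q)"
    proof -
      from retract[of i] True obtain r where "continuous_on X r" "r ` X \<subseteq> Y i"
        "\<forall>p\<in>Y i. connected_component (Y i) p (r p)"
        "\<forall>j\<in>I - {i}. \<forall>p\<in>Y j. \<forall>q\<in>Y j. connected_component (Y i) (r p) (r q)"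
        unfolding retracts_onto_piece_def by blast
      then show ?thesis by (intro that[of r]) simp_all
    qed
    have "Poly_Mapping.lookup (Poly_Mapping.lookup f i) D = 0" if D: "D \<in> components (Y i)" for D
    proof -
      define \<omega> :: "'a set \<Rightarrow> 'f" where "\<omega> C = (if r ` C \<inter> D \<noteq> {} then 1 else 0)" for C
      obtain z where z: "z \<in> Y i" "D = connected_component_set (Y i) z"
        using D by (auto simp: components_def)
      have \<omega>: "\<omega> (comp_image X (connected_component_set (Y j) p)) =
          (if connected_component (Y i) z (r p) then 1 else 0)"
        if j: "j \<in> I" "p \<in> Y j" for j p
      proof -
        let ?C = "connected_component_set X p"
        have C: "connected (r ` ?C)" "r ` ?C \<subseteq> Y i" "r p \<in> r ` ?C"
          using r j sub[of j] connected_component_subset[of X p]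
          by (auto intro!: connected_continuous_image intro: continuous_on_subset)
        then have "r ` ?C \<inter> D \<noteq> {} \<longleftrightarrow> connected_component (Y i) z (r p)"
          unfolding z(2)
          by (smt (verit) connected_component_def connected_component_trans disjoint_iff
              mem_Collect_eq)
        moreover have "comp_image X (connected_component_set (Y j) p) = ?C"
          using j sub by (simp add: comp_image_component)
        ultimately show ?thesis by (simp add: \<omega>_def)
      qed
      have "pairing \<omega> (H0_map X (Poly_Mapping.lookup f j)) =
          (if j = i then Poly_Mapping.lookup (Poly_Mapping.lookup f i) D else 0)"
        if j: "j \<in> I" for j
      proof (cases "j = i")
        case True
        have "\<omega> (comp_image X C) = (if C = D then 1 else 0)"
          if C: "C \<in> Poly_Mapping.keys (Poly_Mapping.lookup f i)" for C
        proof -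
          obtain p where p: "p \<in> Y i" "C = connected_component_set (Y i) p"
            using C fr[OF i] by (auto simp: red_H0_iff components_def)
          have "connected_component (Y i) z (r p) \<longleftrightarrow> connected_component (Y i) z p"
            using own[OF p(1)] by (meson connected_component_sym connected_component_trans)
          also have "\<dots> \<longleftrightarrow> C = D"
            using p z by (simp add: connected_component_eq_eq connected_component_sym_eq)
          finally show ?thesis using \<omega>[OF i p(1)] p(2) by simp
        qed
        then show ?thesis using True by (simp add: pairing_H0_map pairing_indicator)
      next
        case False
        have "\<exists>k. \<forall>C\<in>Poly_Mapping.keys (Poly_Mapping.lookup f j). \<omega> (comp_image X C) = k"
        proof (cases "Y j = {}")
          case True
          then show ?thesis using fr[OF j] by (simp add: red_H0_iff)
        next
          case nonempty: False
          then obtain q where q: "q \<in> Y j" by blast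
          have "\<omega> (comp_image X C) = (if connected_component (Y i) z (r q) then 1 else 0)"
            if C: "C \<in> Poly_Mapping.keys (Poly_Mapping.lookup f j)" for C
          proof -
            obtain p where p: "p \<in> Y j" "C = connected_component_set (Y j) p"
              using C fr[OF j] by (auto simp: red_H0_iff components_def)
            have "connected_component (Y i) z (r p) \<longleftrightarrow> connected_component (Y i) z (r q)"
              using other[OF j False p(1) q]
              by (meson connected_component_sym connected_component_trans)
            then show ?thesis using \<omega>[OF j p(1)] p(2) by simp
          qed
          then show ?thesis by blast
        qed
        then obtain k where
          "\<And>C. C \<in> Poly_Mapping.keys (Poly_Mapping.lookup f j) \<Longrightarrow> \<omega> (comp_image X C) = k"
          by blast
        then have "pairing (\<lambda>C. \<omega> (comp_image X C)) (Poly_Mapping.lookup f j) = 0"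
          using fr[OF j] by (intro pairing_const_on_keys) (auto simp: red_H0_iff)
        then show ?thesis using False by (simp add: pairing_H0_map)
      qed
      then have "pairing \<omega> (glue I X f) = Poly_Mapping.lookup (Poly_Mapping.lookup f i) D"
        using \<open>finite I\<close> i by (simp add: glue_def pairing_sum)
      then show ?thesis using 0 by (simp add: pairing_def)
    qed
    then have "Poly_Mapping.lookup f i = 0"
      using fr[OF i] by (metis in_keys_iff keys_eq_empty red_H0_iff subset_eq ex_in_conv)
    then show ?thesis by simp
  qed
qed

lemma glue_scale:
  fixes f :: "'b \<Rightarrow>\<^sub>0 'a::topological_space set \<Rightarrow>\<^sub>0 'f::field"
  shows "glue I X (Poly_Mapping.mapp (\<lambda>i. Poly_Mapping.map ((*) a)) f) =
    Poly_Mapping.map ((*) a) (glue I X f)"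
proof -
  have 1: "Poly_Mapping.lookup (Poly_Mapping.mapp (\<lambda>i. Poly_Mapping.map ((*) a)) f) i =
      Poly_Mapping.map ((*) a) (Poly_Mapping.lookup f i)" for i
    by (rule lookup_mapp_zero) (simp add: poly_mapping_eq_iff fun_eq_iff lookup_scale)
  have 2: "Poly_Mapping.map ((*) a) (sum F S) = (\<Sum>i\<in>S. Poly_Mapping.map ((*) a) (F i))"
    for F :: "'b \<Rightarrow> 'a set \<Rightarrow>\<^sub>0 'f" and S
    by (intro poly_mapping_eqI) (simp add: lookup_scale lookup_sum sum_distrib_left)
  show ?thesis unfolding glue_def 1 2 H0_map_scale ..
qed

lemma glue_bij:
  fixes Y :: "'b \<Rightarrow> 'a::topological_space set"
  assumes "finite I" and sub: "\<And>i. i \<in> I \<Longrightarrow> Y i \<subseteq> X"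
    and chain: "\<And>p q. p \<in> X \<Longrightarrow> q \<in> X \<Longrightarrow> (p, q) \<in> (share_piece I Y)\<^sup>*"
    and retract: "\<And>i. i \<in> I \<Longrightarrow> Y i \<noteq> {} \<Longrightarrow> \<exists>r. retracts_onto_piece I X Y i r"
  shows "bij_betw (glue I X) (red_H0_family I Y) (red_H0 X :: ('a set \<Rightarrow>\<^sub>0 'f::field) set)"
  unfolding bij_betw_def
proof
  show "inj_on (glue I X) (red_H0_family I Y :: ('b \<Rightarrow>\<^sub>0 'a set \<Rightarrow>\<^sub>0 'f) set)"
  proof (rule inj_onI)
    fix f g :: "'b \<Rightarrow>\<^sub>0 'a set \<Rightarrow>\<^sub>0 'f"
    assume fg: "f \<in> red_H0_family I Y" "g \<in> red_H0_family I Y" "glue I X f = glue I X g"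
    let ?neg = "Poly_Mapping.mapp (\<lambda>i. Poly_Mapping.map ((*) (-1))) g"
    have neg: "?neg = - g"
    proof -
      have "Poly_Mapping.lookup ?neg i = Poly_Mapping.map ((*) (-1)) (Poly_Mapping.lookup g i)" for i
        by (rule lookup_mapp_zero) (simp add: poly_mapping_eq_iff fun_eq_iff lookup_scale)
      then show ?thesis by (intro poly_mapping_eqI) (simp add: lookup_scale)
    qed
    have "Poly_Mapping.map ((*) (-1)) h \<in> red_H0 A"
      if "h \<in> red_H0 A" for h :: "'a set \<Rightarrow>\<^sub>0 'f" and A
      using that by (auto simp: red_H0_iff coeff_sum_scale in_keys_iff lookup_scale)
    moreover have "Poly_Mapping.map ((*) (-1)) h = - h" for h :: "'a set \<Rightarrow>\<^sub>0 'f"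
      by (intro poly_mapping_eqI) (simp add: lookup_scale)
    ultimately have "- g \<in> red_H0_family I Y"
      using fg(2) by (auto simp: red_H0_family_def)
    then have "f + - g \<in> red_H0_family I Y"
      using fg(1) by (rule red_H0_family_add[rotated])
    moreover have "glue I X (f + - g) = 0"
      unfolding glue_add neg[symmetric] glue_scale
      by (intro poly_mapping_eqI) (simp add: fg(3) lookup_add lookup_scale)
    ultimately have "f + - g = 0"
      using glue_inj[OF \<open>finite I\<close> sub retract] by blast
    then show "f = g" by simp
  qed
  show "glue I X ` red_H0_family I Y = (red_H0 X :: ('a set \<Rightarrow>\<^sub>0 'f) set)"
  proof
    show "glue I X ` red_H0_family I Y \<subseteq> (red_H0 X :: ('a set \<Rightarrow>\<^sub>0 'f) set)"
      by (auto simp: glue_def red_H0_family_def intro!: red_H0_sum H0_map_in_red_H0[OF sub])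
    show "(red_H0 X :: ('a set \<Rightarrow>\<^sub>0 'f) set) \<subseteq> glue I X ` red_H0_family I Y"
      using glue_surj[OF \<open>finite I\<close> sub chain] by blast
  qed
qed

text \<open>
  The isomorphism at level \<open>t\<close> is the sum of the maps induced by the inclusions of the pieces.
  It commutes with the structure maps since both composites are induced by the inclusion of the
  lower sublevel set of a piece into the higher sublevel set of \<open>M\<close>.
\<close>

lemma pm_isomorphic_glue:
  fixes M :: "'a::real_inner set" and N :: "'b \<Rightarrow> 'a set"
  assumes sub: "\<And>i. i \<in> I \<Longrightarrow> N i \<subseteq> M"
    and bij: "\<And>t. bij_betw (glue I (sublevel M v t)) (red_H0_family I (\<lambda>i. sublevel (N i) v t))
      (red_H0 (sublevel M v t) :: ('a set \<Rightarrow>\<^sub>0 'f::field) set)"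
  shows "pm_isomorphic (pm_direct_sum I (\<lambda>i. red_PH0 (N i) v))
    (red_PH0 M v :: ('f, 'a set \<Rightarrow>\<^sub>0 'f) pmod)"
proof -
  have space: "pm_space (pm_direct_sum I (\<lambda>i. red_PH0 (N i) v)) t =
      red_H0_family I (\<lambda>i. sublevel (N i) v t)" for t
    by (simp add: pm_direct_sum_def red_PH0_def red_H0_family_def)
  have "glue I (sublevel M v t)
        (Poly_Mapping.mapp (\<lambda>i. H0_map (sublevel (N i) v t)) f) =
      H0_map (sublevel M v t) (glue I (sublevel M v s) f)"
    if st: "s \<le> t" and f: "f \<in> red_H0_family I (\<lambda>i. sublevel (N i) v s)"
    for s t and f :: "'b \<Rightarrow>\<^sub>0 'a set \<Rightarrow>\<^sub>0 'f"
  proof -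
    have look: "Poly_Mapping.lookup (Poly_Mapping.mapp (\<lambda>i. H0_map (sublevel (N i) v t)) f) i =
        H0_map (sublevel (N i) v t) (Poly_Mapping.lookup f i)" for i
      by (rule lookup_mapp_zero) (simp add: H0_map_def)
    have "H0_map (sublevel M v t) (H0_map (sublevel (N i) v t) (Poly_Mapping.lookup f i)) =
        H0_map (sublevel M v t) (H0_map (sublevel M v s) (Poly_Mapping.lookup f i))"
      if i: "i \<in> I" for i
    proof -
      have fi: "Poly_Mapping.lookup f i \<in> red_H0 (sublevel (N i) v s)"
        using f i by (simp add: red_H0_family_def)
      show ?thesis
        using st sub[OF i]
        by (subst (1 2) H0_map_H0_map[OF _ _ fi]) (auto simp: sublevel_def)
    qed
    then show ?thesis by (simp add: glue_def look H0_map_sum)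
  qed
  then have "pm_iso (pm_direct_sum I (\<lambda>i. red_PH0 (N i) v))
      (red_PH0 M v :: ('f, 'a set \<Rightarrow>\<^sub>0 'f) pmod) (\<lambda>t. glue I (sublevel M v t))"
    unfolding pm_iso_def linear_between_def space using bij
    by (auto simp: pm_direct_sum_def red_PH0_def glue_add glue_scale bij_betw_def)
  then show ?thesis unfolding pm_isomorphic_def by blast
qed

section \<open>Edges of a convex polygon\<close>

lemma planar_combination:
  fixes u w z :: "real^2"
  assumes indep: "\<And>\<alpha> \<beta>. \<alpha> *\<^sub>R u + \<beta> *\<^sub>R w = 0 \<Longrightarrow> \<alpha> = 0 \<and> \<beta> = 0"
  obtains \<alpha> \<beta> where "z = \<alpha> *\<^sub>R u + \<beta> *\<^sub>R w"
proof -
  let ?D = "u$1 * w$2 - u$2 * w$1"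
  have "?D \<noteq> 0"
  proof
    assume D: "?D = 0"
    have "w$2 *\<^sub>R u + (- u$2) *\<^sub>R w = 0" "w$1 *\<^sub>R u + (- u$1) *\<^sub>R w = 0"
      using D by (simp_all add: vec_eq_iff forall_2 algebra_simps)
    then have "w$2 = 0" "u$2 = 0" "w$1 = 0" "u$1 = 0" using indep by fastforce+
    then have "1 *\<^sub>R u + 0 *\<^sub>R w = 0" by (simp add: vec_eq_iff forall_2)
    then show False using indep by fastforce
  qed
  then have "z = ((z$1 * w$2 - z$2 * w$1) / ?D) *\<^sub>R u + ((u$1 * z$2 - u$2 * z$1) / ?D) *\<^sub>R w"
    by (simp add: vec_eq_iff forall_2 add_divide_distrib[symmetric] eq_divide_eq)
       (simp add: algebra_simps)
  then show thesis by (rule that)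
qed

lemma edge_support:
  assumes "polytope P" "closed_segment a b edge_of P"
  obtains n d where "\<And>y. y \<in> P \<Longrightarrow> n \<bullet> y \<le> d"
    and "\<And>y. y \<in> P \<Longrightarrow> n \<bullet> y = d \<longleftrightarrow> y \<in> closed_segment a b"
    and "n \<bullet> a = d" "n \<bullet> b = d"
proof -
  have "closed_segment a b exposed_face_of P"
    using assms by (simp add: edge_of_def exposed_face_of_polyhedron polytope_imp_polyhedron)
  then obtain n d where nd: "P \<subseteq> {y. n \<bullet> y \<le> d}" "closed_segment a b = P \<inter> {y. n \<bullet> y = d}"
    unfolding exposed_face_of_def by blast
  then show thesis
    using that[of n d] ends_in_segment[of a b] by blast
qed

lemma edge_endpoints:
  assumes "closed_segment a b edge_of P"
  shows "a \<noteq> b" "a extreme_point_of P" "b extreme_point_of P" "a \<in> P" "b \<in> P"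
proof -
  show "a \<noteq> b" using assms by (auto simp: edge_of_def)
  show "a extreme_point_of P" "b extreme_point_of P"
    using assms extreme_point_of_face[of "closed_segment a b" P]
    by (auto simp: edge_of_def extreme_point_of_segment)
  then show "a \<in> P" "b \<in> P" by (auto simp: extreme_point_of_def)
qed

lemma extreme_point_in_edge:
  assumes "closed_segment a b edge_of P" "e extreme_point_of P" "e \<in> closed_segment a b"
  shows "e = a \<or> e = b"
  using assms extreme_point_of_face[of "closed_segment a b" P e]
  by (simp add: edge_of_def extreme_point_of_segment)

text \<open>
  Three distinct edges at \<open>a\<close>, with directions \<open>u\<^sub>1, u\<^sub>2, u\<^sub>3\<close>, have supporting functionals
  \<open>n\<^sub>1, n\<^sub>2, n\<^sub>3\<close>; each vanishes on its own direction and is negative on the two others. In the plane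
  \<open>u\<^sub>3\<close> is a combination of \<open>u\<^sub>1\<close> and \<open>u\<^sub>2\<close>; evaluating \<open>n\<^sub>1\<close> and \<open>n\<^sub>2\<close> on it shows that both
  coefficients are positive, and then \<open>n\<^sub>3\<close> is negative on \<open>u\<^sub>3\<close>, a contradiction.
\<close>

lemma at_most_two_edges_at_vertex:
  fixes a b\<^sub>1 b\<^sub>2 b\<^sub>3 :: "real^2"
  assumes P: "polytope P"
    and e1: "closed_segment a b\<^sub>1 edge_of P" and e2: "closed_segment a b\<^sub>2 edge_of P"
    and e3: "closed_segment a b\<^sub>3 edge_of P" and ne: "b\<^sub>1 \<noteq> b\<^sub>2"
  shows "b\<^sub>3 = b\<^sub>1 \<or> b\<^sub>3 = b\<^sub>2"
proof (rule ccontr)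
  assume ne3: "\<not> (b\<^sub>3 = b\<^sub>1 \<or> b\<^sub>3 = b\<^sub>2)"
  have support: "\<exists>n. n \<bullet> (b - a) = 0 \<and>
      (\<forall>b'. closed_segment a b' edge_of P \<longrightarrow> b' \<noteq> b \<longrightarrow> n \<bullet> (b' - a) < 0)"
    if e: "closed_segment a b edge_of P" for b
  proof -
    obtain n d where n: "\<And>y. y \<in> P \<Longrightarrow> n \<bullet> y \<le> d"
      "\<And>y. y \<in> P \<Longrightarrow> n \<bullet> y = d \<longleftrightarrow> y \<in> closed_segment a b" "n \<bullet> a = d" "n \<bullet> b = d"
      by (rule edge_support[OF P e]) blast
    have "n \<bullet> b' < d" if b': "closed_segment a b' edge_of P" "b' \<noteq> b" for b'
    proof -
      have "b' \<notin> closed_segment a b"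
        using extreme_point_in_edge[OF e] edge_endpoints[OF b'(1)] b'(2) by blast
      then show ?thesis using n(1,2)[of b'] edge_endpoints[OF b'(1)] by fastforce
    qed
    then show ?thesis
      using n(3,4) by (intro exI[of _ n]) (simp add: inner_diff_right)
  qed
  let ?u1 = "b\<^sub>1 - a" and ?u2 = "b\<^sub>2 - a" and ?u3 = "b\<^sub>3 - a"
  obtain n1 where n1: "n1 \<bullet> ?u1 = 0" "n1 \<bullet> ?u2 < 0" "n1 \<bullet> ?u3 < 0"
    using support[OF e1] e2 e3 ne ne3 by metis
  obtain n2 where n2: "n2 \<bullet> ?u2 = 0" "n2 \<bullet> ?u1 < 0" "n2 \<bullet> ?u3 < 0"
    using support[OF e2] e1 e3 ne ne3 by metis
  obtain n3 where n3: "n3 \<bullet> ?u3 = 0" "n3 \<bullet> ?u1 < 0" "n3 \<bullet> ?u2 < 0"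
    using support[OF e3] e1 e2 ne3 by metis
  have "\<alpha> = 0 \<and> \<beta> = 0" if "\<alpha> *\<^sub>R ?u1 + \<beta> *\<^sub>R ?u2 = 0" for \<alpha> \<beta>
  proof -
    have "n1 \<bullet> (\<alpha> *\<^sub>R ?u1 + \<beta> *\<^sub>R ?u2) = 0" "n2 \<bullet> (\<alpha> *\<^sub>R ?u1 + \<beta> *\<^sub>R ?u2) = 0"
      unfolding that by simp_all
    then show ?thesis using n1(1,2) n2(1,2) unfolding inner_add_right inner_scaleR_right by auto
  qed
  then obtain \<alpha> \<beta> where u3: "?u3 = \<alpha> *\<^sub>R ?u1 + \<beta> *\<^sub>R ?u2"
    by (rule planar_combination)
  have "n1 \<bullet> ?u3 = \<beta> * (n1 \<bullet> ?u2)" "n2 \<bullet> ?u3 = \<alpha> * (n2 \<bullet> ?u1)"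
    "n3 \<bullet> ?u3 = \<alpha> * (n3 \<bullet> ?u1) + \<beta> * (n3 \<bullet> ?u2)"
    unfolding u3 inner_add_right inner_scaleR_right n1(1) n2(1) by simp_all
  with n1 n2 have "\<alpha> > 0" "\<beta> > 0" by (simp_all add: mult_less_0_iff)
  then have "\<alpha> * (n3 \<bullet> ?u1) + \<beta> * (n3 \<bullet> ?u2) < 0"
    using n3 by (simp add: add_neg_neg mult_pos_neg)
  then show False using n3(1) \<open>n3 \<bullet> ?u3 = \<alpha> * (n3 \<bullet> ?u1) + \<beta> * (n3 \<bullet> ?u2)\<close> by simp
qed

section \<open>The triangle spanned by an edge and a point\<close>

lemma hull_triangle_coords:
  fixes a b c :: "'a::real_vector"
  shows "w \<in> convex hull {a, b, c} \<longleftrightarrow>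
    (\<exists>\<alpha> \<beta>. 0 \<le> \<alpha> \<and> 0 \<le> \<beta> \<and> \<alpha> + \<beta> \<le> 1 \<and> w = c + \<alpha> *\<^sub>R (a - c) + \<beta> *\<^sub>R (b - c))"
  (is "_ \<longleftrightarrow> (\<exists>\<alpha> \<beta>. ?Q \<alpha> \<beta>)")
proof
  assume "w \<in> convex hull {a, b, c}"
  then obtain \<alpha> \<beta> \<gamma> where abg: "0 \<le> \<alpha>" "0 \<le> \<beta>" "0 \<le> \<gamma>" "\<alpha> + \<beta> + \<gamma> = 1"
    "w = \<alpha> *\<^sub>R a + \<beta> *\<^sub>R b + \<gamma> *\<^sub>R c"
    by (auto simp: convex_hull_3)
  then have \<gamma>: "\<gamma> = 1 - \<alpha> - \<beta>" by simp
  have "w = c + \<alpha> *\<^sub>R (a - c) + \<beta> *\<^sub>R (b - c)"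
    unfolding abg(5) \<gamma> by (simp add: algebra_simps)
  then have "?Q \<alpha> \<beta>" using abg by simp
  then show "\<exists>\<alpha> \<beta>. ?Q \<alpha> \<beta>" by blast
next
  assume "\<exists>\<alpha> \<beta>. ?Q \<alpha> \<beta>"
  then obtain \<alpha> \<beta> where "?Q \<alpha> \<beta>" by blast
  then show "w \<in> convex hull {a, b, c}"
    unfolding convex_hull_3
    by (intro CollectI exI[of _ \<alpha>] exI[of _ \<beta>] exI[of _ "1 - \<alpha> - \<beta>"]) (simp add: algebra_simps)
qed

lemma segment_from_coords:
  fixes a c :: "'a::real_vector"
  assumes "0 \<le> \<alpha>" "\<alpha> \<le> 1"
  shows "c + \<alpha> *\<^sub>R (a - c) \<in> closed_segment c a"
  using assms unfolding closed_segment_def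
  by (intro CollectI exI[of _ \<alpha>]) (simp add: algebra_simps)

text \<open>
  A center on the boundary of the polygon makes some triangles collapse. A collapsed triangle
  consists of its two spokes, that is, of the segments from the center to the ends of the edge.
\<close>

lemma degenerate_triangle:
  fixes a b c :: "'a::euclidean_space"
  assumes "c \<in> closed_segment a b"
  shows "convex hull {a, b, c} = closed_segment c a \<union> closed_segment c b"
proof -
  have "convex hull {a, b, c} = convex hull {a, b}"
    using assms hull_redundant[of c convex "{a, b}"] by (simp add: segment_convex_hull insert_commute)
  then show ?thesis
    using Un_closed_segment[OF assms] by (simp add: segment_convex_hull insert_commute)
qed

locale polygon_edge =
  fixes P :: "(real^2) set" and a b c :: "real^2"
  assumes polytope: "polytope P" and edge: "closed_segment a b edge_of P"
    and c_in: "c \<in> P" and c_off: "c \<notin> closed_segment a b"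
begin

text \<open>
  The functional that supports the polygon along the edge, measured from \<open>c\<close>, takes the same value
  \<open>\<delta>\<close> at both ends of the edge. So on the polygon the coordinates with respect to \<open>a - c\<close> and
  \<open>b - c\<close> have sum at most 1.
\<close>

lemma cone_functional:
  obtains n \<delta> where "\<delta> > 0" "\<And>y. y \<in> P \<Longrightarrow> n \<bullet> (y - c) \<le> \<delta>"
    "\<And>\<alpha> \<beta>. n \<bullet> (c + \<alpha> *\<^sub>R (a - c) + \<beta> *\<^sub>R (b - c) - c) = (\<alpha> + \<beta>) * \<delta>"
proof -
  obtain n d where n: "\<And>y. y \<in> P \<Longrightarrow> n \<bullet> y \<le> d"
    "\<And>y. y \<in> P \<Longrightarrow> n \<bullet> y = d \<longleftrightarrow> y \<in> closed_segment a b" "n \<bullet> a = d" "n \<bullet> b = d"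
    by (rule edge_support[OF polytope edge]) blast
  show thesis
  proof (rule that[of "d - n \<bullet> c" n])
    show "d - n \<bullet> c > 0" using n(1,2)[OF c_in] c_off by fastforce
    show "n \<bullet> (y - c) \<le> d - n \<bullet> c" if "y \<in> P" for y
      using n(1)[OF that] by (simp add: inner_diff_right)
    show "n \<bullet> (c + \<alpha> *\<^sub>R (a - c) + \<beta> *\<^sub>R (b - c) - c) = (\<alpha> + \<beta>) * (d - n \<bullet> c)" for \<alpha> \<beta>
      using n(3,4) by (simp add: inner_add_right inner_diff_right algebra_simps)
  qed
qed

lemma cone_coords:
  obtains \<alpha> \<beta> where "y = c + \<alpha> *\<^sub>R (a - c) + \<beta> *\<^sub>R (b - c)"
proof -
  obtain n \<delta> where n: "\<delta> > 0"
    "\<And>\<alpha> \<beta>. n \<bullet> (c + \<alpha> *\<^sub>R (a - c) + \<beta> *\<^sub>R (b - c) - c) = (\<alpha> + \<beta>) * \<delta>"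
    by (rule cone_functional) blast
  have "\<alpha> = 0 \<and> \<beta> = 0" if "\<alpha> *\<^sub>R (a - c) + \<beta> *\<^sub>R (b - c) = 0" for \<alpha> \<beta>
  proof -
    have "(\<alpha> + \<beta>) * \<delta> = 0" using n(2)[of \<alpha> \<beta>] that by (simp add: add.assoc)
    then have "\<beta> = - \<alpha>" using n(1) by simp
    then have "\<alpha> *\<^sub>R (a - b) = 0" using that by (simp add: algebra_simps)
    then show ?thesis using \<open>\<beta> = - \<alpha>\<close> edge_endpoints(1)[OF edge] by simp
  qed
  then obtain \<alpha> \<beta> where "y - c = \<alpha> *\<^sub>R (a - c) + \<beta> *\<^sub>R (b - c)"
    by (rule planar_combination)
  then show thesis by (intro that[of \<alpha> \<beta>]) (simp add: algebra_simps)
qed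

lemma cone_Int_polygon:
  assumes "w \<in> P" "0 \<le> \<alpha>" "0 \<le> \<beta>" "w = c + \<alpha> *\<^sub>R (a - c) + \<beta> *\<^sub>R (b - c)"
  shows "w \<in> convex hull {a, b, c}"
proof -
  obtain n \<delta> where n: "\<delta> > 0" "\<And>y. y \<in> P \<Longrightarrow> n \<bullet> (y - c) \<le> \<delta>"
    "\<And>\<alpha> \<beta>. n \<bullet> (c + \<alpha> *\<^sub>R (a - c) + \<beta> *\<^sub>R (b - c) - c) = (\<alpha> + \<beta>) * \<delta>"
    by (rule cone_functional) blast
  then have "(\<alpha> + \<beta>) * \<delta> \<le> 1 * \<delta>" using n(2)[OF assms(1)] assms(4) by simp
  then have "\<alpha> + \<beta> \<le> 1" using n(1) by (simp only: mult_le_cancel_right_pos)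
  then show ?thesis using assms unfolding hull_triangle_coords by blast
qed

lemma triangle_cases:
  assumes "w \<in> convex hull {a, b, c}"
  obtains "w \<in> closed_segment c a \<union> closed_segment c b"
  | \<alpha> \<beta> where "0 < \<alpha>" "0 < \<beta>" "w = c + \<alpha> *\<^sub>R (a - c) + \<beta> *\<^sub>R (b - c)"
proof -
  obtain \<alpha> \<beta> where ab: "0 \<le> \<alpha>" "0 \<le> \<beta>" "\<alpha> + \<beta> \<le> 1" "w = c + \<alpha> *\<^sub>R (a - c) + \<beta> *\<^sub>R (b - c)"
    using assms unfolding hull_triangle_coords by blast
  show thesis
  proof (cases "\<alpha> = 0 \<or> \<beta> = 0")
    case True
    then have "w \<in> closed_segment c a \<union> closed_segment c b"
      using ab segment_from_coords[of \<alpha> c a] segment_from_coords[of \<beta> c b] by auto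
    then show ?thesis by (rule that(1))
  qed (use ab that(2)[of \<alpha> \<beta>] in auto)
qed

text \<open>
  By \<open>cone_Int_polygon\<close> the triangle is the part of the polygon inside the cone spanned at \<open>c\<close> by
  the edge. A path in the polygon that leaves the triangle therefore leaves the cone, and it does so
  on one of the two rays that bound the cone; it cannot leave through the edge.
\<close>

lemma exit_point:
  assumes "y \<in> P" "y \<notin> convex hull {a, b, c}" "z \<in> convex hull {a, b, c}"
    and exit: "\<And>w. w \<in> open_segment z y \<Longrightarrow> w \<notin> convex hull {a, b, c}"
  shows "z \<in> closed_segment c a \<union> closed_segment c b"
  using assms(3)
proof (cases rule: triangle_cases)
  case (2 \<alpha> \<beta>)
  obtain \<alpha>' \<beta>' where y: "y = c + \<alpha>' *\<^sub>R (a - c) + \<beta>' *\<^sub>R (b - c)"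
    by (rule cone_coords)
  \<comment> \<open>Both coordinates of \<open>z\<close> are positive, so they stay nonnegative for a short way towards \<open>y\<close>;
    \<open>s\<close> is an explicit step that is short enough.\<close>
  define K where "K = \<bar>\<alpha>'\<bar> / \<alpha> + \<bar>\<beta>'\<bar> / \<beta>"
  define s where "s = 1 / (2 + K)"
  define w where "w = (1 - s) *\<^sub>R z + s *\<^sub>R y"
  have K: "K \<ge> 0" "\<bar>\<alpha>'\<bar> \<le> K * \<alpha>" "\<bar>\<beta>'\<bar> \<le> K * \<beta>"
    using 2 by (simp_all add: K_def distrib_right)
  then have s: "0 < s" "s < 1" "1 - s = s * (1 + K)"
    by (simp_all add: s_def field_simps)
  have pos: "0 \<le> (1 - s) * x + s * x'" if "0 < x" "\<bar>x'\<bar> \<le> K * x" for x x'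
  proof -
    have "(1 - s) * x + s * x' = s * (x + K * x + x')" by (simp add: s(3) algebra_simps)
    moreover have "0 \<le> x + K * x + x'" using that by linarith
    ultimately show ?thesis using s(1) by simp
  qed
  have "z \<in> P"
  proof -
    have "convex hull {a, b, c} \<subseteq> P"
      using c_in edge_endpoints[OF edge] polytope
      by (intro hull_minimal) (auto simp: polytope_imp_convex)
    then show ?thesis using assms(3) by blast
  qed
  then have "w \<in> P"
    using assms(1) polytope_imp_convex[OF polytope] s unfolding w_def
    by (intro convexD) auto
  moreover have "w = c + ((1 - s) * \<alpha> + s * \<alpha>') *\<^sub>R (a - c) + ((1 - s) * \<beta> + s * \<beta>') *\<^sub>R (b - c)"
    unfolding w_def 2(3) y by (simp add: algebra_simps)
  ultimately have "w \<in> convex hull {a, b, c}"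
    using pos[OF 2(1) K(2)] pos[OF 2(2) K(3)] by (intro cone_Int_polygon) auto
  moreover have "w \<in> open_segment z y"
    using s assms(2,3) unfolding w_def in_segment by auto
  ultimately show ?thesis using exit by blast
qed

end

lemma exit_triangle_through_spoke:
  fixes a b c :: "real^2"
  assumes "polytope P" "closed_segment a b edge_of P" "c \<in> P"
    and "y \<in> P" "y \<notin> convex hull {a, b, c}" "z \<in> convex hull {a, b, c}"
    and "\<And>w. w \<in> open_segment z y \<Longrightarrow> w \<notin> convex hull {a, b, c}"
  shows "z \<in> closed_segment c a \<union> closed_segment c b"
proof (cases "c \<in> closed_segment a b")
  case True
  then show ?thesis using assms(6) degenerate_triangle by blast
next
  case False
  then interpret polygon_edge P a b c using assms by unfold_locales
  show ?thesis using assms by (intro exit_point)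
qed

text \<open>
  A common point off the spokes lies in the interior of both cones at \<open>c\<close>, so the ray from \<open>c\<close>
  through it crosses both edges in their relative interiors. Each crossing is the last point of the
  ray in the polygon, hence the two crossings coincide. An interior point of one edge that lies in another
  face puts the whole edge into that face, so the two edges are equal.
\<close>

lemma triangles_meet_in_spokes:
  fixes a b a' b' c p :: "real^2"
  assumes P: "polytope P" "c \<in> P"
    and e: "closed_segment a b edge_of P" "closed_segment a' b' edge_of P" "{a, b} \<noteq> {a', b'}"
    and p: "p \<in> convex hull {a, b, c}" "p \<in> convex hull {a', b', c}"
  shows "p \<in> closed_segment c a \<union> closed_segment c b \<union> closed_segment c a' \<union> closed_segment c b'"
proof (rule ccontr)
  assume off: "\<not> ?thesis"
  then have c_off: "c \<notin> closed_segment a b" "c \<notin> closed_segment a' b'"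
    using p degenerate_triangle[of c a b] degenerate_triangle[of c a' b'] by auto
  interpret E: polygon_edge P a b c using P e c_off by unfold_locales
  interpret F: polygon_edge P a' b' c using P e c_off by unfold_locales
  obtain \<alpha> \<beta> where ab: "0 < \<alpha>" "0 < \<beta>" "p = c + \<alpha> *\<^sub>R (a - c) + \<beta> *\<^sub>R (b - c)"
    using p(1) off by (cases rule: E.triangle_cases) auto
  obtain \<alpha>' \<beta>' where ab': "0 < \<alpha>'" "0 < \<beta>'" "p = c + \<alpha>' *\<^sub>R (a' - c) + \<beta>' *\<^sub>R (b' - c)"
    using p(2) off by (cases rule: F.triangle_cases) auto
  obtain n \<delta> where n: "\<delta> > 0" "\<And>y. y \<in> P \<Longrightarrow> n \<bullet> (y - c) \<le> \<delta>"
    "\<And>\<alpha> \<beta>. n \<bullet> (c + \<alpha> *\<^sub>R (a - c) + \<beta> *\<^sub>R (b - c) - c) = (\<alpha> + \<beta>) * \<delta>"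
    by (rule E.cone_functional) blast
  obtain n' \<delta>' where n': "\<delta>' > 0" "\<And>y. y \<in> P \<Longrightarrow> n' \<bullet> (y - c) \<le> \<delta>'"
    "\<And>\<alpha> \<beta>. n' \<bullet> (c + \<alpha> *\<^sub>R (a' - c) + \<beta> *\<^sub>R (b' - c) - c) = (\<alpha> + \<beta>) * \<delta>'"
    by (rule F.cone_functional) blast
  define q where "q = c + (1 / (\<alpha> + \<beta>)) *\<^sub>R (p - c)"
  define q' where "q' = c + (1 / (\<alpha>' + \<beta>')) *\<^sub>R (p - c)"
  \<comment> \<open>\<open>q\<close> and \<open>q'\<close> are the points where the ray from \<open>c\<close> through \<open>p\<close> crosses the two edges.\<close>
  have on_edge: "c + (1 / (s + t)) *\<^sub>R (p - c) \<in> open_segment u w"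
    if "0 < s" "0 < t" "p = c + s *\<^sub>R (u - c) + t *\<^sub>R (w - c)" "u \<noteq> w" for s t and u w :: "real^2"
  proof -
    let ?r = "t / (s + t)"
    have r: "0 < ?r" "?r < 1" using that by simp_all
    have "1 / (s + t) * s = 1 - ?r" using that by (simp add: field_simps)
    then have "c + (1 / (s + t)) *\<^sub>R (p - c) = c + (1 - ?r) *\<^sub>R (u - c) + ?r *\<^sub>R (w - c)"
      unfolding that(3) by (simp add: scaleR_add_right)
    also have "\<dots> = (1 - ?r) *\<^sub>R u + ?r *\<^sub>R w" by (simp add: algebra_simps)
    finally show ?thesis using r that(4) unfolding in_segment by blast
  qed
  have q: "q \<in> open_segment a b"
    unfolding q_def using ab edge_endpoints(1)[OF e(1)] by (intro on_edge)
  have q': "q' \<in> open_segment a' b'"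
    unfolding q'_def using ab' edge_endpoints(1)[OF e(2)] by (intro on_edge)
  have inP: "q \<in> P" "q' \<in> P"
    using q q' e open_closed_segment edge_of_imp_subset by blast+
  have "n \<bullet> (p - c) = (\<alpha> + \<beta>) * \<delta>" "n' \<bullet> (p - c) = (\<alpha>' + \<beta>') * \<delta>'"
    using n(3)[of \<alpha> \<beta>] n'(3)[of \<alpha>' \<beta>'] ab(3) ab'(3) by simp_all
  then have "1 / (\<alpha>' + \<beta>') * ((\<alpha> + \<beta>) * \<delta>) \<le> \<delta>" "1 / (\<alpha> + \<beta>) * ((\<alpha>' + \<beta>') * \<delta>') \<le> \<delta>'"
    using n(2)[OF inP(2)] n'(2)[OF inP(1)] by (simp_all add: q_def q'_def)
  moreover have "S \<le> T" if "1 / T * (S * \<epsilon>) \<le> \<epsilon>" "0 < T" "0 < \<epsilon>" for S T \<epsilon> :: real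
    using that by (simp add: pos_divide_le_eq)
  ultimately have "\<alpha> + \<beta> = \<alpha>' + \<beta>'"
    using ab(1,2) ab'(1,2) n(1) n'(1) by (meson add_pos_pos order_antisym)
  then have "q = q'" by (simp add: q_def q'_def)
  then have "a \<in> closed_segment a' b'" "b \<in> closed_segment a' b'"
    using e q q' edge_endpoints(4,5)[OF e(1)] open_closed_segment[of q' a' b']
    unfolding edge_of_def face_of_def by blast+
  then have "a \<in> {a', b'}" "b \<in> {a', b'}"
    using extreme_point_in_edge[OF e(2)] edge_endpoints[OF e(1)] by blast+
  then show False using e(3) edge_endpoints(1)[OF e(1)] by auto
qed

section \<open>The triangles over the edges cover the polygon\<close>

locale cyclic_polygon =
  fixes P :: "(real^2) set" and m :: nat and x :: "nat \<Rightarrow> real^2" and c :: "real^2"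
  assumes polytope: "polytope P" and dim: "aff_dim P = 2"
    and cyclic: "cyclic_vertices P m x" and c_in: "c \<in> P"
begin

abbreviation succ :: "nat \<Rightarrow> nat"
  where "succ i \<equiv> (i + 1) mod (m + 1)"

definition triangle :: "nat \<Rightarrow> (real^2) set"
  where "triangle i = convex hull {x i, x (succ i), c}"

lemma succ_le: "succ i \<le> m"
  using mod_less_divisor[of "m + 1" "i + 1"] by simp

lemma succ_eq: "i \<le> m \<Longrightarrow> succ i = (if i = m then 0 else i + 1)"
  by simp

lemma edge: "i \<le> m \<Longrightarrow> closed_segment (x i) (x (succ i)) edge_of P"
  using cyclic by (simp add: cyclic_vertices_def)

lemma vertex: "i \<le> m \<Longrightarrow> x i extreme_point_of P"
  using cyclic by (auto simp: cyclic_vertices_def bij_betw_def)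

lemma vertexE:
  assumes "p extreme_point_of P" obtains i where "i \<le> m" "p = x i"
proof -
  have "p \<in> x ` {0..m}" using assms cyclic by (simp add: cyclic_vertices_def bij_betw_def)
  then show thesis using that by auto
qed

lemma vertex_inj: "i \<le> m \<Longrightarrow> j \<le> m \<Longrightarrow> x i = x j \<longleftrightarrow> i = j"
  using cyclic by (auto simp: cyclic_vertices_def bij_betw_def inj_on_def)

text \<open>
  This excludes a cycle of two vertices, in which both cyclic edges would be the same segment and
  their triangles would overlap off the spokes.
\<close>

lemma at_least_three_vertices: "2 \<le> m"
proof -
  have "{p. p extreme_point_of P} = x ` {0..m}"
    using cyclic by (simp add: cyclic_vertices_def bij_betw_def)
  then have "P = convex hull (x ` {0..m})"
    using Krein_Milman_Minkowski[of P] polytope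
    by (simp add: polytope_imp_compact polytope_imp_convex)
  then have "aff_dim P \<le> int (card (x ` {0..m})) - 1"
    using aff_dim_le_card[of "x ` {0..m}"] by (simp add: aff_dim_convex_hull)
  also have "\<dots> \<le> int m"
    using card_image_le[of "{0..m}" x] by simp
  finally show ?thesis using dim by simp
qed

text \<open>
  Every vertex already has two edges, to its cyclic predecessor and to its successor, and in the plane
  it has no third one.
\<close>

lemma edge_is_consecutive:
  assumes "closed_segment a b edge_of P"
  obtains i where "i \<le> m" "{a, b} = {x i, x (succ i)}"
proof -
  obtain k where k: "k \<le> m" "a = x k" by (rule vertexE[OF edge_endpoints(2)[OF assms]])
  obtain j where j: "j \<le> m" and j_succ: "succ j = k" and "j \<noteq> succ k"
  proof (cases k)
    case 0
    then show thesis using that[of m] at_least_three_vertices by simp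
  next
    case (Suc l)
    then have "l \<noteq> succ k"
      using k(1) at_least_three_vertices by (simp only: succ_eq split: if_splits) linarith
    then show thesis using that[of l] Suc k(1) by simp
  qed
  then have "x j \<noteq> x (succ k)" using vertex_inj[OF j succ_le] by simp
  moreover have "closed_segment (x k) (x j) edge_of P"
    using edge[OF j] j_succ by (simp add: closed_segment_commute)
  ultimately have "b = x j \<or> b = x (succ k)"
    using at_most_two_edges_at_vertex[OF polytope _ edge[OF k(1)], of "x j" b] assms k(2) by simp
  then show thesis
  proof
    assume "b = x j"
    then show thesis using that[of j] j j_succ k by (simp add: insert_commute)
  next
    assume "b = x (succ k)"
    then show thesis using that[of k] k by simp
  qed
qed

lemma frontier_in_edges:
  assumes "q \<in> frontier P"
  obtains i where "i \<le> m" "q \<in> closed_segment (x i) (x (succ i))"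
proof -
  have "affine hull P = UNIV" using dim by (simp flip: aff_dim_eq_full)
  then have "q \<in> rel_frontier P"
    using assms by (simp add: rel_frontier_def frontier_def rel_interior_interior)
  then obtain F where F: "F facet_of P" "q \<in> F"
    using rel_frontier_of_polyhedron[OF polytope_imp_polyhedron[OF polytope]] by auto
  then have dF: "F face_of P" "aff_dim F = 1" by (auto simp: facet_of_def dim)
  then have "polytope F" using polytope face_of_polytope_polytope by blast
  then obtain a b where ab: "F = closed_segment a b"
    using compact_convex_collinear_segment[of F] F(2) dF(2)
    by (metis collinear_aff_dim empty_iff order_refl polytope_imp_compact polytope_imp_convex)
  then have "closed_segment a b edge_of P" using dF by (simp add: edge_of_def)
  then obtain i where "i \<le> m" "{a, b} = {x i, x (succ i)}" by (rule edge_is_consecutive)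
  then show thesis
    using that[of i] F(2) ab by (metis segment_convex_hull)
qed

text \<open>
  Prolong the segment from \<open>c\<close> through \<open>p\<close> to the frontier, which is a union of edges between
  consecutive vertices; \<open>p\<close> lies in the triangle over the edge that is hit.
\<close>

lemma polygon_covered:
  assumes "p \<in> P"
  obtains i where "i \<le> m" "p \<in> triangle i"
proof (cases "p = c")
  case True
  then have "p \<in> triangle 0" by (simp add: triangle_def hull_inc)
  then show thesis using that[of 0] by simp
next
  case False
  obtain q where q: "q \<in> frontier P" "p \<in> closed_segment c q"
  proof (cases "p \<in> interior P")
    case True
    then obtain d where d: "0 < d" "p + d *\<^sub>R (p - c) \<in> frontier P"
      using ray_to_frontier[of P p "p - c"] False polytope_imp_bounded[OF polytope] by auto
    have "p = c + (1 / (1 + d)) *\<^sub>R ((p + d *\<^sub>R (p - c)) - c)"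
    proof -
      have "(p + d *\<^sub>R (p - c)) - c = (1 + d) *\<^sub>R (p - c)" by (simp add: algebra_simps)
      then show ?thesis using d(1) by simp
    qed
    also have "\<dots> \<in> closed_segment c (p + d *\<^sub>R (p - c))"
      using d(1) by (intro segment_from_coords) simp_all
    finally show thesis using that d(2) by blast
  next
    case False
    then have "p \<in> frontier P"
      using assms closure_subset by (auto simp: frontier_def)
    then show thesis by (rule that) simp
  qed
  from q(1) obtain i where i: "i \<le> m" "q \<in> closed_segment (x i) (x (succ i))"
    by (rule frontier_in_edges)
  have "q \<in> triangle i"
    using i(2) hull_mono[of "{x i, x (succ i)}" "{x i, x (succ i), c}" convex]
    unfolding triangle_def segment_convex_hull by blast
  then have "closed_segment c q \<subseteq> triangle i"
    unfolding triangle_def by (intro closed_segment_subset) (auto simp: hull_inc)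
  then show thesis using that i q(2) by blast
qed

lemma triangle_subset: "i \<le> m \<Longrightarrow> triangle i \<subseteq> P"
  unfolding triangle_def using edge_endpoints(4,5)[OF edge] c_in polytope
  by (intro hull_minimal) (auto simp: polytope_imp_convex)

lemma edges_distinct:
  assumes "i \<le> m" "j \<le> m" "i \<noteq> j"
  shows "{x i, x (succ i)} \<noteq> {x j, x (succ j)}"
proof
  assume "{x i, x (succ i)} = {x j, x (succ j)}"
  then have "x i = x (succ j)" "x (succ i) = x j"
    using vertex_inj assms succ_le by (auto simp: doubleton_eq_iff)
  then have "i = succ j" "j = succ i"
    using vertex_inj assms succ_le by metis+
  then show False
    using assms at_least_three_vertices by (simp only: succ_eq split: if_splits)
qed

end

section \<open>Sublevel sets of a star-shaped set and of its sectors\<close>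

lemma connected_component_segment:
  fixes a b :: "'a::real_normed_vector"
  shows "closed_segment a b \<subseteq> S \<Longrightarrow> connected_component S a b"
  unfolding connected_component_def by (intro exI[of _ "closed_segment a b"]) simp

locale star_polygon = cyclic_polygon "convex hull M" m x c
  for M :: "(real^2) set" and m :: nat and x :: "nat \<Rightarrow> real^2" and c :: "real^2" +
  assumes star: "star_center M c"
begin

lemma center_in: "c \<in> M"
  using star by (simp add: star_center_def)

lemma star_segment: "y \<in> M \<Longrightarrow> closed_segment c y \<subseteq> M"
  using star by (simp add: star_center_def)

lemma sector_eq: "sector M c m x i = triangle i \<inter> M"
  by (simp add: sector_def triangle_def)

text \<open>
  The spokes belong to \<open>M\<close>, and not just to its convex hull: the vertices of the hull are points of
  \<open>M\<close>, and \<open>M\<close> is star-shaped.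
\<close>

lemma spoke_subset: "i \<le> m \<Longrightarrow> closed_segment c (x i) \<subseteq> M"
  by (intro star_segment extreme_point_of_convex_hull vertex)

lemma convex_triangle: "convex (triangle i)" and compact_triangle: "compact (triangle i)"
  by (simp_all add: triangle_def finite_imp_compact_convex_hull)

lemma center_in_triangle: "c \<in> triangle i"
  by (simp add: triangle_def hull_inc)

lemma triangle_Int_subset:
  assumes "i \<le> m" "j \<le> m" "i \<noteq> j"
  shows "triangle i \<inter> triangle j \<subseteq> M"
proof
  fix p assume "p \<in> triangle i \<inter> triangle j"
  then have "p \<in> closed_segment c (x i) \<union> closed_segment c (x (succ i)) \<union>
      closed_segment c (x j) \<union> closed_segment c (x (succ j))"
    using triangles_meet_in_spokes[OF polytope c_in edge[OF assms(1)] edge[OF assms(2)]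
        edges_distinct[OF assms], of p]
    by (simp add: triangle_def)
  then show "p \<in> M"
    using spoke_subset[OF assms(1)] spoke_subset[OF assms(2)] spoke_subset[OF succ_le] by blast
qed

text \<open>
  The sublevel set of the convex hull is connected and is covered by the closed sublevel sets of the
  triangles. If the triangles met by chains from \<open>p\<close> did not include all of them, they would separate
  it, because two distinct triangles that meet below level \<open>t\<close> do so in a point of \<open>M\<close>, which prolongs the
  chain.
\<close>

lemma sector_chain:
  assumes p: "p \<in> sublevel M v t" and q: "q \<in> sublevel M v t"
  shows "(p, q) \<in> (share_piece {0..m} (\<lambda>i. sublevel (sector M c m x i) v t))\<^sup>*"
    (is "_ \<in> ?R\<^sup>*")
proof -
  let ?H = "{y. y \<bullet> v \<le> t}"
  \<comment> \<open>\<open>J\<close> collects the sectors all of whose points are reached by chains from \<open>p\<close>; the triangles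
    over \<open>J\<close> and those over its complement cover the connected set \<open>K\<close> by two disjoint closed sets.\<close>
  define K where "K = convex hull M \<inter> ?H"
  define J where "J = {i \<in> {0..m}. \<forall>z \<in> sublevel (sector M c m x i) v t. (p, z) \<in> ?R\<^sup>*}"
  define A where "A = (\<Union>i\<in>J. triangle i \<inter> ?H)"
  define B where "B = (\<Union>i\<in>{0..m} - J. triangle i \<inter> ?H)"
  have "closed ?H" "convex ?H"
    using closed_halfspace_le[of v t] convex_halfspace_le[of v t] by (simp_all add: inner_commute)
  then have "connected K" and closed: "closed A" "closed B"
    unfolding K_def A_def B_def J_def
    by (auto intro!: convex_connected convex_Int closed_UN closed_Int
        simp: compact_imp_closed compact_triangle)
  have member: "\<exists>i\<le>m. y \<in> sublevel (sector M c m x i) v t \<and> y \<in> triangle i \<inter> ?H"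
    if "y \<in> sublevel M v t" for y
    using that polygon_covered[of y] hull_subset[of M convex]
    by (auto simp: sublevel_def sector_eq)
  have cover: "K \<subseteq> A \<union> B"
  proof
    fix y assume y: "y \<in> K"
    then obtain i where "i \<le> m" "y \<in> triangle i"
      using polygon_covered unfolding K_def by blast
    then show "y \<in> A \<union> B" using y by (auto simp: A_def B_def K_def)
  qed
  have disjoint: "A \<inter> B \<inter> K = {}"
  proof (rule ccontr)
    assume "A \<inter> B \<inter> K \<noteq> {}"
    then obtain z i j where z: "z \<in> triangle i" "z \<in> triangle j" "z \<bullet> v \<le> t"
      and ij: "i \<in> J" "j \<le> m" "j \<notin> J"
      by (auto simp: A_def B_def)
    have "i \<le> m" "i \<noteq> j" using ij by (auto simp: J_def)
    then have "z \<in> M" using triangle_Int_subset[of i j] z ij by blast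
    then have zi: "z \<in> sublevel (sector M c m x i) v t" and zj: "z \<in> sublevel (sector M c m x j) v t"
      using z by (simp_all add: sublevel_def sector_eq)
    from zi ij(1) have "(p, z) \<in> ?R\<^sup>*" by (simp add: J_def)
    moreover have "(z, w) \<in> ?R" if "w \<in> sublevel (sector M c m x j) v t" for w
      using zj ij(2) that by (auto simp: share_piece_def)
    ultimately have "j \<in> J"
      using ij(2) unfolding J_def by (auto intro: rtrancl_into_rtrancl)
    then show False using ij(3) by simp
  qed
  have inK: "y \<in> K" if "y \<in> sublevel M v t" for y
    using that hull_subset[of M convex] by (auto simp: K_def sublevel_def)
  have "A \<inter> K \<noteq> {}"
  proof -
    obtain i where i: "i \<le> m" "p \<in> sublevel (sector M c m x i) v t" "p \<in> triangle i \<inter> ?H"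
      using member[OF p] by blast
    then have "i \<in> J" unfolding J_def by (auto simp: share_piece_def intro!: r_into_rtrancl)
    then show ?thesis using i(3) inK[OF p] by (auto simp: A_def)
  qed
  then have "B \<inter> K = {}"
    using \<open>connected K\<close> closed cover disjoint unfolding connected_closed by blast
  moreover obtain j where j: "j \<le> m" "q \<in> sublevel (sector M c m x j) v t" "q \<in> triangle j \<inter> ?H"
    using member[OF q] by blast
  moreover have "q \<in> B" if "j \<notin> J" using that j by (auto simp: B_def)
  ultimately have "j \<in> J" using inK[OF q] by blast
  then show ?thesis using j(2) by (simp add: J_def)
qed

text \<open>
  If the center has height at most \<open>t\<close>, all sublevel sets are star-shaped and the constant map works.
  Otherwise \<open>\<rho>\<close> moves each point towards \<open>c\<close> until it reaches the line of height \<open>t\<close>, which keeps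
  it inside \<open>M\<close> and inside its triangle. Then the nearest point of \<open>L\<close> is taken, the segment in
  which the line meets the \<open>i\<close>-th triangle. A point of the line outside the triangle goes to an end
  of \<open>L\<close> where the line leaves the triangle within the hull, so by \<open>exit_triangle_through_spoke\<close> to a
  point of a spoke, hence of \<open>M\<close>. The triangle over another edge may contain points of the hull that
  are not in \<open>M\<close>, but the same argument applies to them, so its whole convex sublevel set has a
  connected image in the sector.
\<close>

lemma sector_retraction:
  assumes i: "i \<le> m" and nonempty: "sublevel (sector M c m x i) v t \<noteq> {}"
  shows "\<exists>r. retracts_onto_piece {0..m} (sublevel M v t)
    (\<lambda>i. sublevel (sector M c m x i) v t) i r"
proof -
  let ?Y = "\<lambda>i. sublevel (sector M c m x i) v t"
  have convex_H: "convex {y. y \<bullet> v \<le> t}"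
    using convex_halfspace_le[of v t] by (simp add: inner_commute)
  have segment: "closed_segment y p \<subseteq> ?Y j"
    if "p \<in> ?Y j" "y \<in> closed_segment c p" "y \<bullet> v \<le> t" for p y j
  proof -
    have "closed_segment y p \<subseteq> closed_segment c p"
      using that(2) by (simp add: subset_closed_segment)
    moreover have "closed_segment c p \<subseteq> triangle j \<inter> M"
      using that(1) star_segment[of p] closed_segment_subset[OF center_in_triangle _ convex_triangle]
      by (simp add: sublevel_def sector_eq)
    moreover have "closed_segment y p \<subseteq> {y. y \<bullet> v \<le> t}"
      using that(1,3) by (intro closed_segment_subset convex_H) (simp_all add: sublevel_def)
    ultimately show ?thesis by (auto simp: sublevel_def sector_eq)
  qed
  show ?thesis
  proof (cases "c \<bullet> v \<le> t")
    case True
    have "c \<in> ?Y i"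
      using True center_in center_in_triangle by (simp add: sublevel_def sector_eq)
    moreover have "connected_component (?Y i) p c" if "p \<in> ?Y i" for p
      using segment[OF that, of c] True
      by (intro connected_component_sym[OF connected_component_segment]) simp
    ultimately show ?thesis unfolding retracts_onto_piece_def by (intro exI[of _ "\<lambda>_. c"]) auto
  next
    case False
    then have below: "t < c \<bullet> v" by simp
    define \<rho> where "\<rho> p = c + ((t - c \<bullet> v) / (p \<bullet> v - c \<bullet> v)) *\<^sub>R (p - c)" for p
    define L where "L = triangle i \<inter> {y. y \<bullet> v = t}"
    have \<rho>_level: "\<rho> p \<bullet> v = t" and \<rho>_segment: "\<rho> p \<in> closed_segment c p" if "p \<bullet> v \<le> t" for p
    proof -
      have neg: "p \<bullet> v - c \<bullet> v < 0" using that below by simp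
      then show "\<rho> p \<bullet> v = t" by (simp add: \<rho>_def inner_add_left inner_diff_left)
      show "\<rho> p \<in> closed_segment c p"
        unfolding \<rho>_def using neg that below
        by (intro segment_from_coords) (simp_all add: divide_nonpos_neg neg_divide_le_eq)
    qed
    have \<rho>_triangle: "\<rho> p \<in> triangle j" if "p \<in> triangle j" "p \<bullet> v \<le> t" for p j
      using \<rho>_segment[OF that(2)] closed_segment_subset[OF center_in_triangle that(1) convex_triangle]
      by blast
    have \<rho>_M: "\<rho> p \<in> M" if "p \<in> sublevel M v t" for p
      using that \<rho>_segment star_segment by (auto simp: sublevel_def)
    have \<rho>_cont: "continuous_on {p. p \<bullet> v \<le> t} \<rho>"
      unfolding \<rho>_def using below by (intro continuous_intros) auto
    have level: "closed {y. y \<bullet> v = t}" "convex {y. y \<bullet> v = t}"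
      using closed_hyperplane[of v t] convex_hyperplane[of v t] by (simp_all add: inner_commute)
    then have L: "closed L" "convex L"
      unfolding L_def by (auto intro!: closed_Int convex_Int
          simp: compact_imp_closed compact_triangle convex_triangle)
    have "L \<noteq> {}"
      using nonempty \<rho>_triangle \<rho>_level by (force simp: L_def sublevel_def sector_eq)
    have exit: "closest_point L y \<in> M"
      if y: "y \<in> convex hull M" "y \<bullet> v = t" "y \<notin> triangle i" for y
    proof -
      let ?z = "closest_point L y"
      have z: "?z \<in> triangle i" "?z \<bullet> v = t"
        using closest_point_in_set[OF L(1) \<open>L \<noteq> {}\<close>, of y] by (simp_all add: L_def)
      have "w \<notin> triangle i" if w: "w \<in> open_segment ?z y" for w
      proof
        assume "w \<in> triangle i"
        moreover have "w \<bullet> v = t"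
          using w z(2) y(2) closed_segment_subset[OF _ _ level(2), of ?z y] open_closed_segment
          by blast
        ultimately have "dist y ?z \<le> dist y w"
          using closest_point_le[OF L(1)] by (simp add: L_def)
        moreover have "dist y w < dist y ?z"
          using dist_in_open_segment[OF w] by (simp add: dist_commute)
        ultimately show False by simp
      qed
      then have "?z \<in> closed_segment c (x i) \<union> closed_segment c (x (succ i))"
        using exit_triangle_through_spoke[OF polytope edge[OF i] c_in y(1), of ?z] y(3) z(1)
        unfolding triangle_def by blast
      then show ?thesis using spoke_subset[OF i] spoke_subset[OF succ_le] by blast
    qed
    define r where "r p = closest_point L (\<rho> p)" for p
    have r_cont: "continuous_on {p. p \<bullet> v \<le> t} r"
      unfolding r_def
      using continuous_on_compose[OF \<rho>_cont continuous_on_closest_point[OF L(2,1) \<open>L \<noteq> {}\<close>]]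
      by (simp add: o_def)
    have r_in: "r p \<in> ?Y i"
      if p: "p \<in> convex hull M" "p \<bullet> v \<le> t" and ok: "\<rho> p \<in> triangle i \<Longrightarrow> \<rho> p \<in> M" for p
    proof -
      have "\<rho> p \<in> convex hull M"
        using \<rho>_segment[OF p(2)] closed_segment_subset[OF c_in p(1) convex_convex_hull] by blast
      then have "r p \<in> M"
        using exit[OF _ \<rho>_level[OF p(2)]] ok \<rho>_level[OF p(2)] closest_point_self[of "\<rho> p" L]
        by (cases "\<rho> p \<in> triangle i") (simp_all add: r_def L_def)
      moreover have "r p \<in> L"
        unfolding r_def by (rule closest_point_in_set[OF L(1) \<open>L \<noteq> {}\<close>])
      ultimately show ?thesis by (simp add: L_def sublevel_def sector_eq)
    qed
    have "continuous_on (sublevel M v t) r"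
      using r_cont by (rule continuous_on_subset) (auto simp: sublevel_def)
    moreover have "r ` sublevel M v t \<subseteq> ?Y i"
      using r_in \<rho>_M hull_subset[of M convex] by (auto simp: sublevel_def)
    moreover have "connected_component (?Y i) p (r p)" if p: "p \<in> ?Y i" for p
    proof -
      have pt: "p \<in> triangle i" "p \<bullet> v \<le> t" using p by (simp_all add: sublevel_def sector_eq)
      then have "r p = \<rho> p"
        unfolding r_def by (intro closest_point_self) (simp add: L_def \<rho>_triangle \<rho>_level)
      then show ?thesis
        using segment[OF p \<rho>_segment[OF pt(2)]] \<rho>_level[OF pt(2)]
        by (intro connected_component_sym[OF connected_component_segment]) simp
    qed
    moreover have "connected_component (?Y i) (r p) (r q)"
      if j: "j \<in> {0..m} - {i}" and pq: "p \<in> ?Y j" "q \<in> ?Y j" for j p q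
    proof -
      let ?T = "triangle j \<inter> {y. y \<bullet> v \<le> t}"
      have "connected (r ` ?T)"
        using convex_Int[OF convex_triangle convex_H]
        by (intro connected_continuous_image continuous_on_subset[OF r_cont] convex_connected) auto
      moreover have "r ` ?T \<subseteq> ?Y i"
      proof
        fix y assume "y \<in> r ` ?T"
        then obtain w where w: "w \<in> triangle j" "w \<bullet> v \<le> t" "y = r w" by blast
        have "\<rho> w \<in> M" if "\<rho> w \<in> triangle i"
          using triangle_Int_subset[of i j] i j that \<rho>_triangle[OF w(1,2)] by auto
        then show "y \<in> ?Y i"
          using r_in[of w] w triangle_subset[of j] j by auto
      qed
      moreover have "r p \<in> r ` ?T" "r q \<in> r ` ?T"
        using pq by (auto simp: sublevel_def sector_eq)
      ultimately show ?thesis unfolding connected_component_def by blast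
    qed
    ultimately show ?thesis unfolding retracts_onto_piece_def by blast
  qed
qed

end

theorem theorem3p6:
  fixes M :: "(real^2) set" and c :: "real^2" and m :: nat and x :: "nat \<Rightarrow> real^2"
  assumes "starlike M"
    and "polytope (convex hull M)" and "aff_dim (convex hull M) = 2"
    and "star_center M c"
    and "cyclic_vertices (convex hull M) m x"
  shows "\<forall>v\<in>sphere 0 1.
    pm_isomorphic
      (pm_direct_sum {0..m} (\<lambda>i. red_PH0 (sector M c m x i) v))
      (red_PH0 M v :: ('f::field, (real^2) set \<Rightarrow>\<^sub>0 'f) pmod)"
proof
  fix v :: "real^2"
  interpret star_polygon M m x c
    using assms by unfold_locales (simp_all add: star_center_def hull_inc)
  show "pm_isomorphic (pm_direct_sum {0..m} (\<lambda>i. red_PH0 (sector M c m x i) v))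
      (red_PH0 M v :: ('f, (real^2) set \<Rightarrow>\<^sub>0 'f) pmod)"
  proof (intro pm_isomorphic_glue glue_bij)
    show "sector M c m x i \<subseteq> M" for i by (simp add: sector_def)
    show "sublevel (sector M c m x i) v t \<subseteq> sublevel M v t" for i t
      by (auto simp: sector_def sublevel_def)
  qed (simp_all add: sector_chain sector_retraction)
qed

end
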